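(* Let $N\ge 1$ be an integer, let $\Gamma_N$ be the Barnes multiple gamma function, and let $0\le a_1\le\cdots\le a_n$ and $0\le b_1\le\cdots\le b_n$ be real numbers. Let $f=1/\Gamma_N$ and $W_{1/\Gamma_N}(z)=\prod_{k=1}^n f(z+a_k)\big/\prod_{k=1}^n f(z+b_k)$. Then for all $z$ with $\Re z>0$, $$(-1)^{N}\partial_z^{N-1}\log W_{1/\Gamma_N}(z)=\int_0^\infty e^{-sz}s^{N}h(s)g(s)\,ds=\Gamma(N+1)\int_0^\infty\frac{\phi(t)\,dt}{(z+t)^{N+1}},$$ where, for $s>0$, $$h(s)=\sum_{k=0}^\infty\binom{k+N-1}{N-1}e^{-ks},\qquad g(s)=\frac1{s^2}\sum_{k=1}^n\left(e^{-sa_k}-e^{-sb_k}\right),$$ and $$\phi(t)=\sum_{k=0}^\infty\binom{k+N-1}{N-1}\rho(t-k),\qquad \rho(t)=\sum_{k=1}^n (t-a_k)\mathbf 1_{[a_k,\infty)}(t)-\sum_{k=1}^n (t-b_k)\mathbf 1_{[b_k,\infty)}(t).$$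
   Context: The Hurwitz multiple zeta function is $\zeta_N(s,z)=\sum_{m_1,\ldots,m_N\ge0}(z+m_1+\cdots+m_N)^{-s}$, which extends meromorphically in $s$ to $\mathbb C$; the Barnes multiple gamma function is $\Gamma_N(z)=\exp\left(\partial_s\zeta_N(s,z)|_{s=0}\right)$. It is known that $1/\Gamma_N$ extends to a real entire function of genus $N$, positive on $(0,\infty)$, whose zeros are exactly the points $z=-k$, $k\in\{0,1,2,\ldots\}$, with multiplicity $\binom{k+N-1}{N-1}$. $\Gamma$ (without index) is Euler's gamma function. With $f=1/\Gamma_N$, $\log f$ is the holomorphic branch on $\mathbb C\setminus(-\infty,0]$ that is real on $(0,\infty)$, and $\log W_{1/\Gamma_N}(z)=\sum_{k=1}^n(\log f(z+a_k)-\log f(z+b_k))$. $\partial_z$ is differentiation with respect to $z$ ($\partial_z^0$ the identity), and $\mathbf 1_S$ is the indicator function of $S$.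
   Formalization: The hypothesis a_1+…+a_n = b_1+…+b_n is added; without it both integrals diverge (e.g. N=n=1, a_1=0, b_1=1: the left side is −log z, but the first integrand is e^{-sz}/s). *)

theory Defs
  imports "HOL-Complex_Analysis.Complex_Analysis"
begin

text \<open>
  The Dirichlet series over \<open>m \<in> \<nat>\<^sup>N\<close>, with principal powers. It converges absolutely
  for \<open>Re s > N\<close>.
\<close>
definition hurwitz_multiple_zeta_series :: "nat \<Rightarrow> complex \<Rightarrow> complex \<Rightarrow> complex" where
  "hurwitz_multiple_zeta_series N s z =
     (\<Sum>\<^sub>\<infinity>m\<in>{..<N} \<rightarrow>\<^sub>E (UNIV :: nat set). (z + of_nat (\<Sum>i<N. m i)) powr (- s))"

text \<open>
  The meromorphic continuation in \<open>s\<close>. The qualifier ``nicely'' excludes junk values at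
  isolated points, so that the continuation is unique as a function.
\<close>
definition hurwitz_multiple_zeta :: "nat \<Rightarrow> complex \<Rightarrow> complex \<Rightarrow> complex" where
  "hurwitz_multiple_zeta N s z =
     (THE F. F nicely_meromorphic_on UNIV \<and>
             (\<forall>s. Re s > real N \<longrightarrow> F s = hurwitz_multiple_zeta_series N s z)) s"

text \<open>
  As for \<^const>\<open>Gamma\<close>, the value at the poles is \<open>0\<close>, so that the pointwise
  inverse is the entire function \<open>1 / \<Gamma>\<^sub>N\<close>. For negative non-integers \<open>z\<close> the formula is
  also correct: only finitely many \<open>z + m\<close> are negative, and there the choice of the
  logarithm disappears under the exponential.
\<close>
definition barnes_Gamma :: "nat \<Rightarrow> complex \<Rightarrow> complex" where
  "barnes_Gamma N z =
     (if z \<in> \<int>\<^sub>\<le>\<^sub>0 then 0 else exp (deriv (\<lambda>s. hurwitz_multiple_zeta N s z) 0))"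

text \<open>
  The holomorphic branch of \<open>log f\<close> on the plane slit along \<open>(-\<infinity>, 0]\<close> that is real on
  the positive axis. It is determined by these conditions on the slit plane only; its values
  on the slit are irrelevant.
\<close>
definition log_branch :: "(complex \<Rightarrow> complex) \<Rightarrow> complex \<Rightarrow> complex" where
  "log_branch f = (SOME L. L holomorphic_on (- \<real>\<^sub>\<le>\<^sub>0) \<and>
                           (\<forall>z\<in>- \<real>\<^sub>\<le>\<^sub>0. exp (L z) = f z) \<and>
                           (\<forall>x::real. x > 0 \<longrightarrow> L (of_real x) \<in> \<real>))"

definition log_W ::
  "(complex \<Rightarrow> complex) \<Rightarrow> nat \<Rightarrow> (nat \<Rightarrow> real) \<Rightarrow> (nat \<Rightarrow> real) \<Rightarrow> complex \<Rightarrow> complex" where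
  "log_W f n a b z =
     (\<Sum>k=1..n. log_branch f (z + of_real (a k)) - log_branch f (z + of_real (b k)))"

definition h_fun :: "nat \<Rightarrow> real \<Rightarrow> real" where
  "h_fun N s = (\<Sum>k. real ((k + N - 1) choose (N - 1)) * exp (- (real k * s)))"

definition g_fun :: "nat \<Rightarrow> (nat \<Rightarrow> real) \<Rightarrow> (nat \<Rightarrow> real) \<Rightarrow> real \<Rightarrow> real" where
  "g_fun n a b s = 1 / s\<^sup>2 * (\<Sum>k=1..n. exp (- (s * a k)) - exp (- (s * b k)))"

definition rho :: "nat \<Rightarrow> (nat \<Rightarrow> real) \<Rightarrow> (nat \<Rightarrow> real) \<Rightarrow> real \<Rightarrow> real" where
  "rho n a b t = (\<Sum>k=1..n. (t - a k) * indicator {a k..} t)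
               - (\<Sum>k=1..n. (t - b k) * indicator {b k..} t)"

text \<open>
  For nonnegative \<open>a\<close>, \<open>b\<close> only the terms with \<open>k \<le> t\<close> can be nonzero. If
  \<open>\<Sum>a\<^sub>k = \<Sum>b\<^sub>k\<close>, then \<^const>\<open>rho\<close> has compact support and
  \<open>phi N n a b t = O(t\<^bsup>N-1\<^esup>)\<close>; otherwise \<open>phi N n a b t\<close> grows like a nonzero multiple
  of \<open>t\<^sup>N\<close> and \<open>g_fun n a b s\<close> like a nonzero multiple of \<open>1/s\<close> as \<open>s \<rightarrow> 0\<close>,
  so that neither \<open>\<integral> e\<^bsup>-sz\<^esup> s\<^sup>N h(s) g(s) ds\<close> nor
  \<open>\<integral> \<phi>(t) (z+t)\<^bsup>-N-1\<^esup> dt\<close> converges.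
\<close>
definition phi :: "nat \<Rightarrow> nat \<Rightarrow> (nat \<Rightarrow> real) \<Rightarrow> (nat \<Rightarrow> real) \<Rightarrow> real \<Rightarrow> real" where
  "phi N n a b t = (\<Sum>k. real ((k + N - 1) choose (N - 1)) * rho n a b (t - real k))"

end

theory Submission
  imports Defs
begin

text \<open>
  Write \<open>Z\<^sub>N(s, z)\<close> for the multiple zeta series. The theorem is about the coefficient of \<open>s\<close> in
  the expansion at \<open>s = 0\<close> of the differences
  \<open>D(s, z) = \<Sum>\<^sub>k Z\<^sub>N(s, z + a\<^sub>k) - Z\<^sub>N(s, z + b\<^sub>k)\<close>, differentiated \<open>N - 1\<close> times in \<open>z\<close>.

  \<^bold>\<open>Where the identity comes from.\<close> The function \<open>\<rho>\<close> is the second antiderivative of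
  \<open>\<Sum>\<^sub>k \<delta>(a\<^sub>k) - \<delta>(b\<^sub>k)\<close> and has compact support because the two sums of shifts agree. Since
  \<open>\<partial>\<^sub>z Z\<^sub>N(s, z) = -s Z\<^sub>N(s + 1, z)\<close>, two integrations by parts give
  \<open>D(s, z) = s (s + 1) \<integral> \<rho>(u) Z\<^sub>N(s + 2, z + u) du\<close>, and \<open>N - 1\<close> further derivatives give
  \<open>\<partial>\<^sub>z\<^bsup>N-1\<^esup> D(s, z) = (-1)\<^bsup>N-1\<^esup> s (s + 1) \<dots> (s + N) \<integral> \<rho>(u) Z\<^sub>N(s + N + 1, z + u) du\<close>.
  Both steps are made for \<open>Re s > N\<close>, where the series converges. The right-hand side is holomorphic for
  \<open>Re s > -1\<close>, so the identity persists there by analytic continuation, and the factor \<open>s\<close> makes the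
  derivative at \<open>s = 0\<close> equal to \<open>(-1)\<^bsup>N-1\<^esup> N! \<integral> \<rho>(u) Z\<^sub>N(N + 1, z + u) du\<close>
  (\<open>higher_deriv_zeta_ext_diff\<close>, \<open>higher_deriv_log_W\<close>). The last integral is expanded into the
  series of \<open>Z\<^sub>N(N + 1, \<cdot>)\<close>. Translating the \<open>m\<close>-th term by \<open>m\<close> produces the integral over \<open>\<phi>\<close>
  (\<open>set_integral_phi\<close>); writing \<open>N! / (w + u)\<^bsup>N+1\<^esup>\<close> as the integral of \<open>s\<^sup>N e\<^bsup>-s(w + u)\<^esup>\<close> and
  using that the Laplace transform of \<open>\<rho>\<close> is \<open>g\<close> produces the integral over \<open>h g\<close>
  (\<open>set_integral_laplace_h_g\<close>).

  \<^bold>\<open>The continuation in \<open>s\<close>.\<close> For this argument the continuation must be understood well enough to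
  exchange \<open>\<partial>\<^sub>s\<close> and \<open>\<partial>\<^sub>z\<close>. On the slit plane, integration by parts on \<open>[0, 1]\<close> and the difference
  equation \<open>Z\<^sub>N(s, z) - Z\<^sub>N(s, z + 1) = Z\<^bsub>N-1\<^esub>(s, z)\<close> give
  \<open>(s - 1) Z\<^sub>N(s, z) = Z\<^bsub>N-1\<^esub>(s - 1, z) + (s - 1) s \<integral>\<^sub>0\<^sup>1 (1 - u) Z\<^sub>N(s + 1, z + u) du\<close>.
  Once the factors \<open>(s - 1) \<dots> (s - N)\<close> are cleared this has no poles, and its right-hand side only uses
  values of \<open>Z\<^sub>N\<close> one unit further to the right. It therefore extends
  \<open>(s - 1) \<dots> (s - N) Z\<^sub>N(s, z)\<close> to all \<open>s\<close>, one unit at a time, as a function that is jointly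
  continuous and holomorphic in each variable (\<open>ex_zeta_continuation\<close>). Such functions have mixed
  derivatives that commute (\<open>has_field_derivative_higher_deriv_param\<close>). In particular
  \<open>\<partial>\<^sub>s Z\<^sub>N(0, z)\<close> is holomorphic on the slit plane; it is real for \<open>z > 0\<close> by conjugation symmetry, so
  its negative is the required branch of \<open>log (1 / \<Gamma>\<^sub>N)\<close>.
\<close>

section \<open>Functions holomorphic in each of two variables\<close>

definition jointly_holomorphic_on ::
  "(complex \<Rightarrow> complex \<Rightarrow> complex) \<Rightarrow> complex set \<Rightarrow> complex set \<Rightarrow> bool" where
  "jointly_holomorphic_on V S Z \<longleftrightarrow>
     continuous_on (S \<times> Z) (\<lambda>(s, z). V s z) \<and>
     (\<forall>z\<in>Z. (\<lambda>s. V s z) holomorphic_on S) \<and> (\<forall>s\<in>S. V s holomorphic_on Z)"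

lemma jointly_holomorphic_onI:
  assumes "continuous_on (S \<times> Z) (\<lambda>(s, z). V s z)"
    and "\<And>z. z \<in> Z \<Longrightarrow> (\<lambda>s. V s z) holomorphic_on S"
    and "\<And>s. s \<in> S \<Longrightarrow> V s holomorphic_on Z"
  shows "jointly_holomorphic_on V S Z"
  using assms by (auto simp: jointly_holomorphic_on_def)

lemma jointly_holomorphic_onD:
  assumes "jointly_holomorphic_on V S Z"
  shows "continuous_on (S \<times> Z) (\<lambda>(s, z). V s z)"
    and "\<And>z. z \<in> Z \<Longrightarrow> (\<lambda>s. V s z) holomorphic_on S"
    and "\<And>s. s \<in> S \<Longrightarrow> V s holomorphic_on Z"
  using assms by (auto simp: jointly_holomorphic_on_def)

lemma jointly_holomorphic_on_subset:
  assumes "jointly_holomorphic_on V S Z" "S' \<subseteq> S" "Z' \<subseteq> Z"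
  shows "jointly_holomorphic_on V S' Z'"
proof (rule jointly_holomorphic_onI)
  show "continuous_on (S' \<times> Z') (\<lambda>(s, z). V s z)"
    using jointly_holomorphic_onD(1)[OF assms(1)]
    by (rule continuous_on_subset) (use assms in auto)
qed (use assms holomorphic_on_subset jointly_holomorphic_onD(2,3)[OF assms(1)] in blast)+

lemma jointly_holomorphic_on_cong:
  assumes "jointly_holomorphic_on V S Z"
    and "\<And>s z. s \<in> S \<Longrightarrow> z \<in> Z \<Longrightarrow> V s z = W s z"
  shows "jointly_holomorphic_on W S Z"
proof (rule jointly_holomorphic_onI)
  show "continuous_on (S \<times> Z) (\<lambda>(s, z). W s z)"
    using jointly_holomorphic_onD(1)[OF assms(1)]
    by (rule continuous_on_eq) (use assms(2) in auto)
next
  fix z assume z: "z \<in> Z"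
  show "(\<lambda>s. W s z) holomorphic_on S"
    using jointly_holomorphic_onD(2)[OF assms(1) z]
    by (rule holomorphic_transform) (use assms(2) z in auto)
next
  fix s assume s: "s \<in> S"
  show "W s holomorphic_on Z"
    using jointly_holomorphic_onD(3)[OF assms(1) s]
    by (rule holomorphic_transform) (use assms(2) s in auto)
qed

lemma jointly_holomorphic_on_compose:
  assumes V: "jointly_holomorphic_on V S Z"
    and p: "p holomorphic_on S'" "p ` S' \<subseteq> S"
    and q: "q holomorphic_on Z'" "q ` Z' \<subseteq> Z"
  shows "jointly_holomorphic_on (\<lambda>s z. V (p s) (q z)) S' Z'"
proof (rule jointly_holomorphic_onI)
  have pq: "continuous_on (S' \<times> Z') (\<lambda>x. (p (fst x), q (snd x)))"
  proof (rule continuous_on_Pair)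
    show "continuous_on (S' \<times> Z') (\<lambda>x. p (fst x))"
      by (rule continuous_on_compose2[OF holomorphic_on_imp_continuous_on[OF p(1)]])
         (auto intro!: continuous_intros)
    show "continuous_on (S' \<times> Z') (\<lambda>x. q (snd x))"
      by (rule continuous_on_compose2[OF holomorphic_on_imp_continuous_on[OF q(1)]])
         (auto intro!: continuous_intros)
  qed
  have "continuous_on (S' \<times> Z') (\<lambda>x. (\<lambda>(s, z). V s z) (p (fst x), q (snd x)))"
    by (rule continuous_on_compose2[OF jointly_holomorphic_onD(1)[OF V] pq])
       (use p q in auto)
  then show "continuous_on (S' \<times> Z') (\<lambda>(s, z). V (p s) (q z))"
    by (simp add: case_prod_unfold)
next
  fix z assume z: "z \<in> Z'"
  have "((\<lambda>s. V s (q z)) \<circ> p) holomorphic_on S'"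
    by (rule holomorphic_on_compose_gen[OF p(1) jointly_holomorphic_onD(2)[OF V]])
       (use p q z in auto)
  then show "(\<lambda>s. V (p s) (q z)) holomorphic_on S'"
    by (simp add: o_def)
next
  fix s assume s: "s \<in> S'"
  have "(V (p s) \<circ> q) holomorphic_on Z'"
    by (rule holomorphic_on_compose_gen[OF q(1) jointly_holomorphic_onD(3)[OF V]])
       (use p q s in auto)
  then show "(\<lambda>z. V (p s) (q z)) holomorphic_on Z'"
    by (simp add: o_def)
qed

lemma jointly_holomorphic_on_left:
  assumes "f holomorphic_on S"
  shows "jointly_holomorphic_on (\<lambda>s z. f s) S Z"
proof (rule jointly_holomorphic_onI)
  have "continuous_on (S \<times> Z) (\<lambda>x. f (fst x))"
    by (rule continuous_on_compose2[OF holomorphic_on_imp_continuous_on[OF assms]])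
       (auto intro!: continuous_intros)
  then show "continuous_on (S \<times> Z) (\<lambda>(s, z). f s)"
    by (simp add: case_prod_unfold)
qed (use assms in auto)

lemma jointly_holomorphic_on_add:
  assumes "jointly_holomorphic_on V S Z" "jointly_holomorphic_on W S Z"
  shows "jointly_holomorphic_on (\<lambda>s z. V s z + W s z) S Z"
  using assms unfolding jointly_holomorphic_on_def case_prod_unfold
  by (intro conjI ballI continuous_intros holomorphic_intros) auto

lemma jointly_holomorphic_on_diff:
  assumes "jointly_holomorphic_on V S Z" "jointly_holomorphic_on W S Z"
  shows "jointly_holomorphic_on (\<lambda>s z. V s z - W s z) S Z"
  using assms unfolding jointly_holomorphic_on_def case_prod_unfold
  by (intro conjI ballI continuous_intros holomorphic_intros) auto

lemma jointly_holomorphic_on_mult: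
  assumes "jointly_holomorphic_on V S Z" "jointly_holomorphic_on W S Z"
  shows "jointly_holomorphic_on (\<lambda>s z. V s z * W s z) S Z"
  using assms unfolding jointly_holomorphic_on_def case_prod_unfold
  by (intro conjI ballI continuous_intros holomorphic_intros) auto

lemma jointly_holomorphic_on_sum:
  assumes "\<And>i. i \<in> I \<Longrightarrow> jointly_holomorphic_on (V i) S Z"
  shows "jointly_holomorphic_on (\<lambda>s z. \<Sum>i\<in>I. V i s z) S Z"
  using assms unfolding jointly_holomorphic_on_def case_prod_unfold
  by (intro conjI ballI continuous_intros holomorphic_intros) auto

text \<open>
  Convergence is only asked on products of compact sets, which is what the Weierstrass test
  delivers for the zeta series.
\<close>
lemma jointly_holomorphic_on_uniform_limit:
  assumes V: "\<And>n. jointly_holomorphic_on (V n) S Z" and "open S" "open Z"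
    and lim: "\<And>K L. compact K \<Longrightarrow> K \<subseteq> S \<Longrightarrow> compact L \<Longrightarrow> L \<subseteq> Z \<Longrightarrow>
      uniform_limit (K \<times> L) (\<lambda>n (s, z). V n s z) (\<lambda>(s, z). G s z) sequentially"
  shows "jointly_holomorphic_on G S Z"
proof (rule jointly_holomorphic_onI)
  have "isCont (\<lambda>(s, z). G s z) x" if x: "x \<in> S \<times> Z" for x
  proof -
    obtain s z where [simp]: "x = (s, z)" and sz: "s \<in> S" "z \<in> Z"
      using x by auto
    obtain r1 where r1: "r1 > 0" "cball s r1 \<subseteq> S" using \<open>open S\<close> sz(1) open_contains_cball by blast
    obtain r2 where r2: "r2 > 0" "cball z r2 \<subseteq> Z" using \<open>open Z\<close> sz(2) open_contains_cball by blast
    have "continuous_on (cball s r1 \<times> cball z r2) (\<lambda>(s, z). G s z)"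
    proof (rule uniform_limit_theorem[OF _ lim])
      show "\<forall>\<^sub>F n in sequentially. continuous_on (cball s r1 \<times> cball z r2) (\<lambda>(s, z). V n s z)"
        by (intro always_eventually allI continuous_on_subset[OF jointly_holomorphic_onD(1)[OF V]])
           (use r1 r2 in auto)
    qed (use r1 r2 in auto)
    moreover have "x \<in> interior (cball s r1 \<times> cball z r2)"
      using r1 r2 by (simp add: interior_Times)
    ultimately show ?thesis by (rule continuous_on_interior)
  qed
  then show "continuous_on (S \<times> Z) (\<lambda>(s, z). G s z)"
    by (intro continuous_at_imp_continuous_on) auto
next
  fix z assume z: "z \<in> Z"
  show "(\<lambda>s. G s z) holomorphic_on S"
  proof (rule holomorphic_uniform_sequence[OF \<open>open S\<close> jointly_holomorphic_onD(2)[OF V z]])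
    fix s assume s: "s \<in> S"
    obtain r where r: "r > 0" "cball s r \<subseteq> S" using \<open>open S\<close> s open_contains_cball by blast
    have "uniform_limit (cball s r) (\<lambda>n s. V n s z) (\<lambda>s. G s z) sequentially"
      using lim[OF compact_cball r(2), of "{z}"] z
      by (auto simp: uniform_limit_iff)
    with r show "\<exists>d>0. cball s d \<subseteq> S \<and> uniform_limit (cball s d) (\<lambda>n s. V n s z) (\<lambda>s. G s z)
        sequentially"
      by blast
  qed
next
  fix s assume s: "s \<in> S"
  show "G s holomorphic_on Z"
  proof (rule holomorphic_uniform_sequence[OF \<open>open Z\<close> jointly_holomorphic_onD(3)[OF V s]])
    fix z assume z: "z \<in> Z"
    obtain r where r: "r > 0" "cball z r \<subseteq> Z" using \<open>open Z\<close> z open_contains_cball by blast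
    have "uniform_limit (cball z r) (\<lambda>n z. V n s z) (\<lambda>z. G s z) sequentially"
      using lim[OF _ _ compact_cball r(2), of "{s}"] s
      by (auto simp: uniform_limit_iff)
    with r show "\<exists>d>0. cball z d \<subseteq> Z \<and> uniform_limit (cball z d) (\<lambda>n z. V n s z) (G s) sequentially"
      by blast
  qed
qed

text \<open>
  If \<open>t\<close> is close to \<open>t\<^sub>0\<close>, then \<open>f(\<cdot>, t) - f(\<cdot>, t\<^sub>0)\<close> is uniformly small on a closed disc, by compactness;
  Cauchy's inequality makes its derivative small on a smaller disc.
\<close>
lemma continuous_on_deriv_param:
  fixes f :: "complex \<Rightarrow> 'a::topological_space \<Rightarrow> complex"
  assumes cont: "continuous_on (S \<times> T) (\<lambda>(s, t). f s t)" and S: "open S"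
    and hol: "\<And>t. t \<in> T \<Longrightarrow> (\<lambda>s. f s t) holomorphic_on S"
  shows "continuous_on (S \<times> T) (\<lambda>(s, t). deriv (\<lambda>s. f s t) s)"
  unfolding continuous_on_def
proof safe
  fix s0 t0 assume s0: "s0 \<in> S" and t0: "t0 \<in> T"
  show "((\<lambda>(s, t). deriv (\<lambda>s. f s t) s) \<longlongrightarrow> deriv (\<lambda>s. f s t0) s0) (at (s0, t0) within S \<times> T)"
  proof (rule tendstoI)
    fix e :: real assume e: "e > 0"
    obtain r where r: "r > 0" "cball s0 (2 * r) \<subseteq> S"
      using S s0 open_contains_cball
      by (metis field_sum_of_halves half_gt_zero_iff mult_2)
    have "continuous_on (T \<times> cball s0 (2 * r)) (\<lambda>x. (\<lambda>(s, t). f s t) (snd x, fst x))"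
      by (rule continuous_on_compose2[OF cont]) (use r in \<open>auto intro!: continuous_intros\<close>)
    then have "continuous_on (T \<times> cball s0 (2 * r)) (\<lambda>(t, s). f s t)"
      by (simp add: case_prod_unfold)
    then obtain T0 where T0: "t0 \<in> T0" "open T0"
        "\<forall>t\<in>T0 \<inter> T. \<forall>s\<in>cball s0 (2 * r). dist (f s t) (f s t0) \<le> e / 3 * r"
      by (rule continuous_on_prod_compactE[of T "cball s0 (2 * r)" _ t0 "e / 3 * r"])
         (use e r t0 in auto)
    have "continuous_on S (deriv (\<lambda>s. f s t0))"
      by (intro holomorphic_on_imp_continuous_on holomorphic_deriv hol S t0)
    then have "isCont (deriv (\<lambda>s. f s t0)) s0"
      using S s0 by (simp add: continuous_on_eq_continuous_at)
    then have "(deriv (\<lambda>s. f s t0) \<longlongrightarrow> deriv (\<lambda>s. f s t0) s0) (nhds s0)"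
      unfolding isCont_def by (simp add: tendsto_at_iff_tendsto_nhds)
    then have "\<forall>\<^sub>F s in nhds s0. dist (deriv (\<lambda>s. f s t0) s) (deriv (\<lambda>s. f s t0) s0) < e / 2"
      by (rule tendstoD) (use e in simp)
    then obtain S0 where S0: "open S0" "s0 \<in> S0"
        "\<And>s. s \<in> S0 \<Longrightarrow> dist (deriv (\<lambda>s. f s t0) s) (deriv (\<lambda>s. f s t0) s0) < e / 2"
      unfolding eventually_nhds by blast
    have close: "dist (deriv (\<lambda>s. f s t) s) (deriv (\<lambda>s. f s t0) s0) < e"
      if s: "s \<in> S0 \<inter> ball s0 r" and t: "t \<in> T0 \<inter> T" for s t
    proof -
      have sub: "cball s r \<subseteq> cball s0 (2 * r)"
      proof
        fix w assume "w \<in> cball s r"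
        then show "w \<in> cball s0 (2 * r)" using s dist_triangle[of s0 w s] by auto
      qed
      then have subS: "cball s r \<subseteq> S" using r by blast
      have fd: "(\<lambda>s. f s t') field_differentiable at s" if "t' \<in> T" for t'
        using holomorphic_on_imp_differentiable_at[OF hol[OF that] S] subS r by force
      have hd: "(\<lambda>s. f s t - f s t0) holomorphic_on S"
        using hol t t0 by (intro holomorphic_intros) auto
      \<comment> \<open>The disc of radius \<open>r\<close> about \<open>s\<close> lies in the disc of radius \<open>2 r\<close> about \<open>s0\<close>,
          where \<open>T0\<close> controls \<open>f\<close>.\<close>
      have "norm ((deriv ^^ 1) (\<lambda>s. f s t - f s t0) s) \<le> fact 1 * (e / 3 * r) / r ^ 1"
      proof (rule Cauchy_inequality)
        show "(\<lambda>s. f s t - f s t0) holomorphic_on ball s r"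
          using hd by (rule holomorphic_on_subset) (use subS in auto)
        show "continuous_on (cball s r) (\<lambda>s. f s t - f s t0)"
          using holomorphic_on_imp_continuous_on[OF hd]
              by (rule continuous_on_subset) (use subS in auto)
      qed (use r T0 t sub in \<open>auto simp: dist_norm subset_iff\<close>)
      moreover have "deriv (\<lambda>s. f s t - f s t0) s = deriv (\<lambda>s. f s t) s - deriv (\<lambda>s. f s t0) s"
        by (rule deriv_diff) (use fd t t0 in auto)
      ultimately have "dist (deriv (\<lambda>s. f s t) s) (deriv (\<lambda>s. f s t0) s) \<le> e / 3"
        using r by (simp add: dist_norm)
      moreover have "dist (deriv (\<lambda>s. f s t0) s) (deriv (\<lambda>s. f s t0) s0) < e / 2"
        using S0 s by auto
      ultimately show ?thesis
        using dist_triangle[of "deriv (\<lambda>s. f s t) s" "deriv (\<lambda>s. f s t0) s0" "deriv (\<lambda>s. f s t0) s"] e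
        by linarith
    qed
    show "\<forall>\<^sub>F x in at (s0, t0) within S \<times> T.
            dist (case x of (s, t) \<Rightarrow> deriv (\<lambda>s. f s t) s) (deriv (\<lambda>s. f s t0) s0) < e"
      unfolding eventually_at_topological
      by (rule exI[of _ "(S0 \<inter> ball s0 r) \<times> T0"])
         (use S0 T0 r s0 t0 close in \<open>auto intro!: open_Times\<close>)
  qed
qed

text \<open>
  Differentiation under the integral sign needs the derivative of the integrand to be jointly
  continuous, which \<open>continuous_on_deriv_param\<close> supplies.
\<close>
lemma holomorphic_on_integral_param:
  fixes f :: "complex \<Rightarrow> real \<Rightarrow> complex"
  assumes cont: "continuous_on (S \<times> {c..d}) (\<lambda>(s, t). f s t)" and S: "open S"
    and hol: "\<And>t. t \<in> {c..d} \<Longrightarrow> (\<lambda>s. f s t) holomorphic_on S"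
  shows "(\<lambda>s. integral {c..d} (f s)) holomorphic_on S"
proof (rule analytic_imp_holomorphic)
  show "(\<lambda>s. integral {c..d} (f s)) analytic_on S"
    unfolding analytic_on_def
  proof
    fix s assume s: "s \<in> S"
    then obtain r where r: "r > 0" "ball s r \<subseteq> S" using S open_contains_ball by blast
    have "(\<lambda>s. integral (cbox c d) (f s)) holomorphic_on ball s r"
    proof (rule leibniz_rule_holomorphic[where fx = "\<lambda>x t. deriv (\<lambda>x. f x t) x"])
      fix x t assume "x \<in> ball s r" "t \<in> cbox c d"
      then show "((\<lambda>x. f x t) has_field_derivative deriv (\<lambda>x. f x t) x) (at x within ball s r)"
        using r
        by (intro has_field_derivative_at_within[OF holomorphic_derivI[OF hol S]]) auto
    next
      fix x assume "x \<in> ball s r"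
      then have "continuous_on {c..d} (\<lambda>t. (\<lambda>(s, t). f s t) (x, t))"
        by (intro continuous_on_compose2[OF cont] continuous_intros) (use r in auto)
      then show "f x integrable_on cbox c d"
        by (auto intro!: integrable_continuous_real)
    next
      show "continuous_on (ball s r \<times> cbox c d) (\<lambda>(x, t). deriv (\<lambda>x. f x t) x)"
        using continuous_on_deriv_param[OF cont S hol]
        by (rule continuous_on_subset) (use r in auto)
    qed auto
    then show "\<exists>e>0. (\<lambda>s. integral {c..d} (f s)) holomorphic_on ball s e" using r(1)
        unfolding cbox_interval by blast
  qed
qed

lemma jointly_holomorphic_on_integral:
  assumes V: "jointly_holomorphic_on V S Z" "open S" "open Z"
    and k: "continuous_on {c..d} k"
    and Z: "\<And>z u. z \<in> Z \<Longrightarrow> u \<in> {c..d::real} \<Longrightarrow> z + of_real u \<in> Z"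
  shows "jointly_holomorphic_on (\<lambda>s z. integral {c..d} (\<lambda>u. k u * V s (z + of_real u))) S Z"
proof (rule jointly_holomorphic_onI)
  have VV: "continuous_on A (\<lambda>x. V (p x) (q x))"
    if "continuous_on A p" "continuous_on A q" "\<And>x. x \<in> A \<Longrightarrow> p x \<in> S \<and> q x \<in> Z"
    for p q and A :: "'x::topological_space set"
  proof -
    have "continuous_on A (\<lambda>x. (p x, q x))" by (intro continuous_intros that)
    then show ?thesis
      using continuous_on_compose2[OF jointly_holomorphic_onD(1)[OF V(1)], of A "\<lambda>x. (p x, q x)"] that
      by fastforce
  qed
  have kk: "continuous_on A (\<lambda>x. k (p x))" if "continuous_on A p" "p ` A \<subseteq> {c..d}"
    for p and A :: "'x::topological_space set"
    by (rule continuous_on_compose2[OF k that])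
  have "continuous_on ((S \<times> Z) \<times> cbox c d) (\<lambda>(x, u). k u * V (fst x) (snd x + of_real u))"
    unfolding case_prod_unfold
    by (intro continuous_intros VV kk) (auto intro!: Z)
  from integral_continuous_on_param[OF this]
  show "continuous_on (S \<times> Z) (\<lambda>(s, z). integral {c..d} (\<lambda>u. k u * V s (z + of_real u)))"
    by (simp add: case_prod_unfold)
next
  have VV: "continuous_on A (\<lambda>x. V (p x) (q x))"
    if "continuous_on A p" "continuous_on A q" "\<And>x. x \<in> A \<Longrightarrow> p x \<in> S \<and> q x \<in> Z"
    for p q and A :: "(complex \<times> real) set"
  proof -
    have "continuous_on A (\<lambda>x. (p x, q x))" by (intro continuous_intros that)
    then show ?thesis
      using continuous_on_compose2[OF jointly_holomorphic_onD(1)[OF V(1)], of A "\<lambda>x. (p x, q x)"] that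
      by fastforce
  qed
  have kk: "continuous_on A (\<lambda>x. k (snd x))" if "snd ` A \<subseteq> {c..d}"
    for A :: "(complex \<times> real) set"
    by (rule continuous_on_compose2[OF k _ that]) (intro continuous_intros)
  {
    fix z assume z: "z \<in> Z"
    show "(\<lambda>s. integral {c..d} (\<lambda>u. k u * V s (z + of_real u))) holomorphic_on S"
    proof (rule holomorphic_on_integral_param[OF _ V(2)])
      show "continuous_on (S \<times> {c..d}) (\<lambda>(s, u). k u * V s (z + of_real u))"
        unfolding case_prod_unfold
        by (intro continuous_intros VV kk) (auto intro!: Z z)
      show "(\<lambda>s. k u * V s (z + of_real u)) holomorphic_on S" if "u \<in> {c..d}" for u
        by (intro holomorphic_intros jointly_holomorphic_onD(2)[OF V(1)] Z z that)
    qed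
  }
  fix s assume s: "s \<in> S"
  show "(\<lambda>z. integral {c..d} (\<lambda>u. k u * V s (z + of_real u))) holomorphic_on Z"
  proof (rule holomorphic_on_integral_param[OF _ V(3)])
    show "continuous_on (Z \<times> {c..d}) (\<lambda>(z, u). k u * V s (z + of_real u))"
      unfolding case_prod_unfold
      by (intro continuous_intros VV kk) (auto intro!: Z s)
    show "(\<lambda>z. k u * V s (z + of_real u)) holomorphic_on Z" if "u \<in> {c..d}" for u
    proof (intro holomorphic_intros)
      have "(\<lambda>z. z + of_real u) holomorphic_on Z" by (intro holomorphic_intros)
      from holomorphic_on_compose_gen[OF this jointly_holomorphic_onD(3)[OF V(1) s]] Z that
      show "(\<lambda>z. V s (z + of_real u)) holomorphic_on Z" by (auto simp: o_def image_subset_iff)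
    qed
  qed
qed

text \<open>
  The difference quotients in \<open>s\<close> are holomorphic in \<open>z\<close> and converge locally uniformly, by the mean
  value inequality and the joint continuity of \<open>\<partial>\<^sub>s V\<close>. Hence all their \<open>z\<close>-derivatives converge as
  well, which shows at once that \<open>\<partial>\<^sub>s V(s\<^sub>0, \<cdot>)\<close> is holomorphic, that \<open>\<partial>\<^sub>z\<^sup>j V(\<cdot>, z)\<close> is
  differentiable, and that the two kinds of derivative commute.
\<close>
lemma
  assumes V: "jointly_holomorphic_on V S Z" and S: "open S" "s0 \<in> S" and Z: "open Z"
  shows has_field_derivative_higher_deriv_param: "z \<in> Z \<Longrightarrow>
     ((\<lambda>s. (deriv ^^ j) (V s) z) has_field_derivative
        (deriv ^^ j) (\<lambda>z. deriv (\<lambda>s. V s z) s0) z) (at s0)"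
   and holomorphic_on_deriv_param: "(\<lambda>z. deriv (\<lambda>s. V s z) s0) holomorphic_on Z"
proof -
  define V' where "V' s z = deriv (\<lambda>s. V s z) s" for s z
  define q where "q h z = (V (s0 + h) z - V s0 z) / h" for h z
  have cont': "continuous_on (S \<times> Z) (\<lambda>(s, z). V' s z)"
    unfolding V'_def using continuous_on_deriv_param[OF jointly_holomorphic_onD(1)[OF V] S(1)]
      jointly_holomorphic_onD(2)[OF V] by simp
  have ul: "uniform_limit (cball z0 r) q (V' s0) (at 0)" if r: "cball z0 r \<subseteq> Z" for z0 r
  proof (rule uniform_limitI)
    fix e :: real assume e: "e > 0"
    have "continuous_on (S \<times> cball z0 r) (\<lambda>(s, z). V' s z)"
      using cont' by (rule continuous_on_subset) (use r in auto)
    then obtain X0 where X0: "s0 \<in> X0" "open X0"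
        "\<forall>s\<in>X0 \<inter> S. \<forall>z\<in>cball z0 r. dist (V' s z) (V' s0 z) \<le> e / 2"
      using continuous_on_prod_compactE[of S "cball z0 r" "\<lambda>(s, z). V' s z" s0 "e / 2"] S e
      by (metis (no_types, lifting) case_prod_conv compact_cball half_gt_zero)
    have "open (X0 \<inter> S)" "s0 \<in> X0 \<inter> S" using X0 S by auto
    then obtain d where d: "d > 0" "ball s0 d \<subseteq> X0 \<inter> S"
      using open_contains_ball by blast
    have "dist (q h z) (V' s0 z) < e" if h: "h \<noteq> 0" "norm h < d" and z: "z \<in> cball z0 r" for h z
    proof -
      \<comment> \<open>The mean value inequality for \<open>s \<mapsto> V s z - s * V' s0 z\<close>, whose derivative is small near \<open>s0\<close>.\<close>
      have "norm ((V (s0 + h) z - (s0 + h) * V' s0 z) - (V s0 z - s0 * V' s0 z))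
              \<le> e / 2 * norm ((s0 + h) - s0)"
      proof (rule field_differentiable_bound)
        fix s assume s: "s \<in> ball s0 d"
        have "((\<lambda>s. V s z) has_field_derivative V' s z) (at s within ball s0 d)"
          unfolding V'_def
          using S s d z r
          by (intro has_field_derivative_at_within[OF holomorphic_derivI[OF
                jointly_holomorphic_onD(2)[OF V] S(1)]]) auto
        then show "((\<lambda>s. V s z - s * V' s0 z) has_field_derivative V' s z - V' s0 z)
            (at s within ball s0 d)"
          by (auto intro!: derivative_eq_intros)
        show "norm (V' s z - V' s0 z) \<le> e / 2"
          using X0 d s z by (auto simp: dist_norm subset_iff)
      qed (use d h in \<open>auto simp: dist_norm\<close>)
      also have "(V (s0 + h) z - (s0 + h) * V' s0 z) - (V s0 z - s0 * V' s0 z) = h * (q h z - V' s0 z)"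
        using h by (simp add: q_def field_simps)
      finally have "norm (q h z - V' s0 z) \<le> e / 2"
        using h by (simp add: norm_mult)
      then show ?thesis using e by (simp add: dist_norm)
    qed
    then show "\<forall>\<^sub>F h in at 0. \<forall>z\<in>cball z0 r. dist (q h z) (V' s0 z) < e"
      unfolding eventually_at using d(1) by (intro exI[of _ d]) auto
  qed
  have ev: "\<forall>\<^sub>F h in at 0. s0 + h \<in> S"
  proof -
    have "(\<lambda>h. s0 + h) \<midarrow>0\<rightarrow> s0" by (auto intro!: tendsto_eq_intros)
    then show ?thesis using S by (rule topological_tendstoD)
  qed
  have qhol: "\<forall>\<^sub>F h in at 0. h \<noteq> 0 \<and> s0 + h \<in> S \<and> q h holomorphic_on Z"
    using ev eventually_neq_at_within[of 0]
  proof eventually_elim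
    case (elim h)
    then show ?case
      unfolding q_def[abs_def]
      by (auto intro!: holomorphic_intros jointly_holomorphic_onD(3)[OF V] S)
  qed
  show hol': "(\<lambda>z. deriv (\<lambda>s. V s z) s0) holomorphic_on Z"
  proof (rule analytic_imp_holomorphic, unfold analytic_on_def, rule ballI)
    fix z assume "z \<in> Z"
    then obtain r where r: "r > 0" "cball z r \<subseteq> Z" using Z open_contains_cball by blast
    have "V' s0 holomorphic_on ball z r"
    proof (rule holomorphic_uniform_limit[OF _ ul[OF r(2)]])
      show "\<forall>\<^sub>F h in at 0. continuous_on (cball z r) (q h) \<and> q h holomorphic_on ball z r"
        using qhol
      proof eventually_elim
        case (elim h)
        then have "q h holomorphic_on cball z r" using holomorphic_on_subset r(2) by blast
        moreover have "q h holomorphic_on ball z r" using elim r(2) holomorphic_on_subset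
          by (meson ball_subset_cball subset_trans)
        ultimately show ?case using holomorphic_on_imp_continuous_on by blast
      qed
    qed auto
    then show "\<exists>e>0. (\<lambda>z. deriv (\<lambda>s. V s z) s0) holomorphic_on ball z e"
      using r(1) unfolding V'_def by blast
  qed
  assume z: "z \<in> Z"
  then obtain r where r: "r > 0" "cball z r \<subseteq> Z" using Z open_contains_cball by blast
  have "((\<lambda>h. (deriv ^^ j) (q h) z) \<longlongrightarrow> (deriv ^^ j) (V' s0) z) (at 0)"
  proof (rule higher_deriv_complex_uniform_limit)
    show "uniform_limit (ball z r) q (V' s0) (at 0)"
      using ul[OF r(2)] by (rule uniform_limit_on_subset) auto
    show "\<forall>\<^sub>F h in at 0. q h holomorphic_on ball z r"
      using qhol by eventually_elim (use r in \<open>auto elim!: holomorphic_on_subset\<close>)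
  qed (use r in auto)
  moreover have "\<forall>\<^sub>F h in at 0. (deriv ^^ j) (q h) z =
      ((deriv ^^ j) (V (s0 + h)) z - (deriv ^^ j) (V s0) z) / h"
    using qhol
  proof eventually_elim
    case (elim h)
    have h1: "V (s0 + h) holomorphic_on Z" "V s0 holomorphic_on Z"
      using jointly_holomorphic_onD(3)[OF V] elim S by auto
    have "(deriv ^^ j) (q h) z = (deriv ^^ j) (\<lambda>z. inverse h * (V (s0 + h) z - V s0 z)) z"
      by (simp add: q_def[abs_def] field_simps)
    also have "\<dots> = inverse h * (deriv ^^ j) (\<lambda>z. V (s0 + h) z - V s0 z) z"
      by (rule higher_deriv_cmult[of _ Z]) (use h1 z Z in \<open>auto intro!: holomorphic_intros\<close>)
    also have "(deriv ^^ j) (\<lambda>z. V (s0 + h) z - V s0 z) z = (deriv ^^ j) (V (s0 + h)) z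
        - (deriv ^^ j) (V s0) z"
      by (rule higher_deriv_diff[of _ Z]) (use h1 z Z in auto)
    finally show ?case by (simp add: field_simps)
  qed
  ultimately have "((\<lambda>h. ((deriv ^^ j) (V (s0 + h)) z - (deriv ^^ j) (V s0) z) / h)
      \<longlongrightarrow> (deriv ^^ j) (V' s0) z) (at 0)"
    by (rule Lim_transform_eventually)
  then show "((\<lambda>s. (deriv ^^ j) (V s) z) has_field_derivative
        (deriv ^^ j) (\<lambda>z. deriv (\<lambda>s. V s z) s0) z) (at s0)"
    unfolding V'_def by (simp add: DERIV_def)
qed

section \<open>The multiple zeta series on the slit plane\<close>

text \<open>
  The recursion removes the last of the \<open>N\<close> parts and sums over the total \<open>i\<close> of the others. In this form
  the difference equation of the zeta series is immediate, and \<open>N = 0\<close> is a correct base case, which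
  the binomial coefficient \<open>(m + N - 1) choose (N - 1)\<close> does not provide with truncated subtraction.
\<close>
primrec num_compositions :: "nat \<Rightarrow> nat \<Rightarrow> nat" where
  "num_compositions 0 m = (if m = 0 then 1 else 0)"
| "num_compositions (Suc N) m = (\<Sum>i\<le>m. num_compositions N i)"

lemma num_compositions_eq_binomial:
  assumes "N \<ge> 1"
  shows "num_compositions N m = (m + N - 1) choose (N - 1)"
proof -
  have "num_compositions (Suc M) m = (m + M) choose M" for M m
  proof (induction M arbitrary: m)
    case 0
    show ?case by (induction m) auto
  next
    case (Suc M)
    have "(\<Sum>i\<le>m. (i + M) choose M) = (m + Suc M) choose Suc M"
      by (induction m) auto
    then show ?case using Suc by simp
  qed
  from this[of "N - 1"] assms show ?thesis by simp
qed

text \<open>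
  The growth rate \<open>m\<^bsup>N-1\<^esup>\<close>, multiplied by \<open>m\<close> so that it also holds for \<open>N = 0\<close>.
\<close>
lemma num_compositions_le: "num_compositions N m * m \<le> (m + 1) ^ N"
proof (cases N)
  case (Suc M)
  have "num_compositions (Suc M) m \<le> (m + 1) ^ M" for M m
  proof (induction M arbitrary: m)
    case 0
    show ?case by (induction m) auto
  next
    case (Suc M)
    have "num_compositions (Suc (Suc M)) m \<le> (\<Sum>i\<le>m. (m + 1) ^ M)"
      using Suc by (subst num_compositions.simps(2), intro sum_mono)
        (meson Suc_eq_plus1 add_le_mono1 atMost_iff order_trans power_mono zero_le)
    then show ?case by simp
  qed
  then have "num_compositions N m * m \<le> (m + 1) ^ M * (m + 1)"
    unfolding Suc by (intro mult_le_mono) auto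
  then show ?thesis by (simp add: Suc algebra_simps)
qed auto

abbreviation slit_plane :: "complex set" where
  "slit_plane \<equiv> - \<real>\<^sub>\<le>\<^sub>0"

lemma open_slit_plane: "open slit_plane"
  by (simp add: open_Compl)

lemma slit_plane_add_real:
  assumes "z \<in> slit_plane" "x \<ge> 0"
  shows "z + of_real x \<in> slit_plane"
  using assms by (auto simp: complex_nonpos_Reals_iff)

lemma slit_plane_add_nat:
  assumes "z \<in> slit_plane"
  shows "z + of_nat m \<in> slit_plane"
  using slit_plane_add_real[OF assms, of "of_nat m"] by simp

lemma jointly_holomorphic_on_powr:
  "jointly_holomorphic_on (\<lambda>s z. z powr (- s)) UNIV slit_plane"
proof (rule jointly_holomorphic_on_cong)
  show "jointly_holomorphic_on (\<lambda>s z. exp (- s * Ln z)) UNIV slit_plane"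
  proof (rule jointly_holomorphic_onI)
    show "continuous_on (UNIV \<times> slit_plane) (\<lambda>(s, z). exp (- s * Ln z))"
      unfolding case_prod_unfold by (intro continuous_intros) auto
  qed (auto intro!: holomorphic_intros)
qed (auto simp: powr_def)

text \<open>
  The multiple zeta series with the terms of equal total \<open>m = m\<^sub>1 + \<dots> + m\<^sub>N\<close> collected.
\<close>
definition zeta_sum :: "nat \<Rightarrow> complex \<Rightarrow> complex \<Rightarrow> complex" where
  "zeta_sum N s z = (\<Sum>m. of_nat (num_compositions N m) * (z + of_nat m) powr (- s))"

lemma norm_powr_minus_le:
  assumes "1 \<le> r" "r \<le> norm w" "0 \<le> \<sigma>" "\<sigma> \<le> Re s"
  shows "norm (w powr (- s)) \<le> exp (\<bar>Im s\<bar> * pi) * r powr (- \<sigma>)"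
proof -
  have w: "w \<noteq> 0" using assms by auto
  have "norm (w powr (- s)) = exp (Im s * Im (Ln w) + (- Re s) * ln (norm w))"
    using w by (simp add: powr_def norm_exp_eq_Re)
  also have "\<dots> \<le> exp (\<bar>Im s\<bar> * pi + (- \<sigma>) * ln r)"
  proof -
    have "\<bar>Im (Ln w)\<bar> \<le> pi"
      using mpi_less_Im_Ln[OF w] Im_Ln_le_pi[OF w] by auto
    then have "\<bar>Im s * Im (Ln w)\<bar> \<le> \<bar>Im s\<bar> * pi"
      unfolding abs_mult by (intro mult_left_mono) auto
    moreover have "\<sigma> * ln r \<le> Re s * ln (norm w)"
      using assms by (intro mult_mono ln_mono) auto
    ultimately show ?thesis by auto
  qed
  also have "\<dots> = exp (\<bar>Im s\<bar> * pi) * r powr (- \<sigma>)"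
    using assms by (simp only: exp_add powr_def) simp
  finally show ?thesis .
qed

lemma summable_num_compositions_powr:
  assumes "\<sigma> > real N"
  shows "summable (\<lambda>m. real (num_compositions N m) * (real m / 2) powr (- \<sigma>))"
proof (rule summable_comparison_test_ev)
  show "summable (\<lambda>m. 2 ^ N * 2 powr \<sigma> * real m powr (real N - 1 - \<sigma>))"
    using assms by (intro summable_mult) (simp add: summable_real_powr_iff)
  show "\<forall>\<^sub>F m in sequentially. norm (real (num_compositions N m) * (real m / 2) powr (- \<sigma>))
          \<le> 2 ^ N * 2 powr \<sigma> * real m powr (real N - 1 - \<sigma>)"
    using eventually_gt_at_top[of 0]
  proof eventually_elim
    case (elim m)
    have "real (num_compositions N m) * real m \<le> (real m + 1) ^ N"
      using num_compositions_le[of N m]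
          by (metis of_nat_1 of_nat_add of_nat_le_iff of_nat_mult of_nat_power)
    also have "\<dots> \<le> (2 * real m) ^ N"
      using elim by (intro power_mono) auto
    finally have *: "real (num_compositions N m) \<le> 2 ^ N * (real m ^ N / real m)"
      using elim by (simp add: field_simps power_mult_distrib)
    have "norm (real (num_compositions N m) * (real m / 2) powr (- \<sigma>))
            \<le> (2 ^ N * (real m ^ N / real m)) * (real m / 2) powr (- \<sigma>)"
      using mult_right_mono[OF *, of "(real m / 2) powr (- \<sigma>)"] by (simp add: abs_mult)
    also have "\<dots> = 2 ^ N * 2 powr \<sigma> * real m powr (real N - 1 - \<sigma>)"
      using elim by (simp add: powr_divide powr_diff powr_minus powr_realpow powr_add field_simps)
    finally show ?case .
  qed
qed

text \<open>
  On compact sets \<open>Re s\<close> stays above some \<open>\<sigma> > N\<close> and \<open>Im s\<close>, \<open>z\<close> stay bounded. For large \<open>m\<close> this gives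
  \<open>norm (z + m) \<ge> m / 2\<close>, and the argument of \<open>z + m\<close> contributes only a bounded factor.
\<close>
lemma zeta_sum_majorant:
  assumes K: "compact K" "K \<subseteq> {s. Re s > real N}" and L: "compact L"
  obtains M where "summable M"
    "\<forall>\<^sub>F m in sequentially. \<forall>s\<in>K. \<forall>z\<in>L.
       norm (of_nat (num_compositions N m) * (z + of_nat m) powr (- s)) \<le> M m"
proof -
  obtain \<sigma> where \<sigma>: "\<sigma> > real N" "\<And>s. s \<in> K \<Longrightarrow> \<sigma> \<le> Re s"
  proof (cases "K = {}")
    case True
    then show ?thesis using that[of "real N + 1"] by auto
  next
    case False
    have "compact (Re ` K)"
      by (intro compact_continuous_image K continuous_intros)
    from compact_attains_inf[OF this] False obtain s where "s \<in> K" "\<forall>s'\<in>K. Re s \<le> Re s'"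
      by auto
    then show ?thesis using that[of "Re s"] K by auto
  qed
  obtain B where B: "\<And>s. s \<in> K \<Longrightarrow> norm s \<le> B"
    using compact_imp_bounded[OF K(1)] by (auto simp: bounded_iff)
  obtain C where C: "\<And>z. z \<in> L \<Longrightarrow> norm z \<le> C"
    using compact_imp_bounded[OF L(1)] by (auto simp: bounded_iff)
  define M where "M m = exp (B * pi) * (real (num_compositions N m) * (real m / 2) powr (- \<sigma>))" for m
  show ?thesis
  proof (rule that)
    show "summable M"
      unfolding M_def by (intro summable_mult summable_num_compositions_powr \<sigma>)
    have "norm (of_nat (num_compositions N m) * (z + of_nat m) powr (- s)) \<le> M m"
      if m: "real m \<ge> max 2 (2 * C)" and s: "s \<in> K" and z: "z \<in> L" for m s z
    proof -
      have "real m / 2 \<le> real m - C" using m by auto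
      also have "\<dots> \<le> norm (of_nat m :: complex) - norm z" using C[OF z] by simp
      also have "\<dots> \<le> norm (z + of_nat m)"
        using norm_triangle_ineq2[of "of_nat m" "- z"] by (simp add: add.commute)
      finally have "norm ((z + of_nat m) powr (- s)) \<le> exp (\<bar>Im s\<bar> * pi) * (real m / 2) powr (- \<sigma>)"
        using m \<sigma>(1) \<sigma>(2)[OF s] by (intro norm_powr_minus_le) auto
      also have "\<dots> \<le> exp (B * pi) * (real m / 2) powr (- \<sigma>)"
        using B[OF s] abs_Im_le_cmod[of s] by (intro mult_right_mono) (auto intro: order_trans)
      finally show ?thesis
        by (simp add: M_def norm_mult mult.left_commute mult_left_mono)
    qed
    moreover have "\<forall>\<^sub>F m in sequentially. real m \<ge> max 2 (2 * C)"
      using filterlim_real_sequentially unfolding filterlim_at_top by (rule spec)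
    ultimately show "\<forall>\<^sub>F m in sequentially. \<forall>s\<in>K. \<forall>z\<in>L.
       norm (of_nat (num_compositions N m) * (z + of_nat m) powr (- s)) \<le> M m"
      by (auto elim!: eventually_mono)
  qed
qed

lemma summable_norm_zeta_sum:
  assumes "Re s > real N"
  shows "summable (\<lambda>m. norm (of_nat (num_compositions N m) * (z + of_nat m) powr (- s)))"
proof -
  obtain M where M: "summable M" "\<forall>\<^sub>F m in sequentially. \<forall>s\<in>{s}. \<forall>z\<in>{z}.
       norm (of_nat (num_compositions N m) * (z + of_nat m) powr (- s)) \<le> M m"
    using zeta_sum_majorant[of "{s}" N "{z}"] assms by auto
  show ?thesis
    by (rule summable_comparison_test_ev[OF _ M(1)]) (use M(2) in simp)
qed

lemma summable_zeta_sum: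
  assumes "Re s > real N"
  shows "summable (\<lambda>m. of_nat (num_compositions N m) * (z + of_nat m) powr (- s))"
  using summable_norm_zeta_sum[OF assms] by (rule summable_norm_cancel)

lemma uniform_limit_zeta_sum:
  assumes "compact K" "K \<subseteq> {s. Re s > real N}" "compact L"
  shows "uniform_limit (K \<times> L)
           (\<lambda>n (s, z). \<Sum>m<n. of_nat (num_compositions N m) * (z + of_nat m) powr (- s))
           (\<lambda>(s, z). zeta_sum N s z) sequentially"
proof -
  obtain M where M: "summable M" "\<forall>\<^sub>F m in sequentially. \<forall>s\<in>K. \<forall>z\<in>L.
       norm (of_nat (num_compositions N m) * (z + of_nat m) powr (- s)) \<le> M m"
    by (rule zeta_sum_majorant[OF assms])
  have "uniform_limit (K \<times> L)
       (\<lambda>n x. \<Sum>m<n. of_nat (num_compositions N m) * (snd x + of_nat m) powr (- fst x))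
       (\<lambda>x. \<Sum>m. of_nat (num_compositions N m) * (snd x + of_nat m) powr (- fst x)) sequentially"
    by (rule Weierstrass_m_test_ev[OF _ M(1)]) (use M(2) in \<open>auto elim!: eventually_mono\<close>)
  then show ?thesis by (simp add: zeta_sum_def case_prod_unfold)
qed

lemma open_halfplane_Re_gt: "open {s. Re s > c}"
  by (simp add: open_halfspace_Re_gt)

lemma jointly_holomorphic_on_zeta_sum:
  "jointly_holomorphic_on (zeta_sum N) {s. Re s > real N} slit_plane"
proof (rule jointly_holomorphic_on_uniform_limit[OF _ open_halfplane_Re_gt open_slit_plane])
  fix n
  show "jointly_holomorphic_on
     (\<lambda>s z. \<Sum>m<n. of_nat (num_compositions N m) * (z + of_nat m) powr (- s)) {s. Re s > real N}
         slit_plane"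
  proof (intro jointly_holomorphic_on_sum jointly_holomorphic_on_mult)
    fix m
    show "jointly_holomorphic_on (\<lambda>s z. (z + of_nat m) powr (- s)) {s. Re s > real N} slit_plane"
      by (rule jointly_holomorphic_on_compose[OF jointly_holomorphic_on_powr, of "\<lambda>s. s"])
         (use slit_plane_add_nat in \<open>auto intro!: holomorphic_intros simp: image_subset_iff\<close>)
  qed (intro jointly_holomorphic_on_left holomorphic_intros)
qed (rule uniform_limit_zeta_sum)

lemma deriv_zeta_sum:
  assumes s: "Re s > real N" and z: "z \<in> slit_plane"
  shows "deriv (zeta_sum N s) z = - s * zeta_sum N (s + 1) z"
proof -
  obtain r where r: "r > 0" "cball z r \<subseteq> slit_plane"
    using open_slit_plane z open_contains_cball by blast
  let ?f = "\<lambda>n z. \<Sum>m<n. of_nat (num_compositions N m) * (z + of_nat m) powr (- s)"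
  have der: "(?f n has_field_derivative
      (\<Sum>m<n. of_nat (num_compositions N m) * (- s * (w + of_nat m) powr (- s - 1)))) (at w)"
    if "w \<in> slit_plane" for w n
    using slit_plane_add_nat[OF that]
    by (intro DERIV_sum DERIV_cmult)
       (auto intro!: derivative_eq_intros has_field_derivative_powr)
  have "(\<lambda>n. (deriv ^^ 1) (?f n) z) \<longlonglongrightarrow> (deriv ^^ 1) (zeta_sum N s) z"
  proof (rule higher_deriv_complex_uniform_limit)
    have "uniform_limit ({s} \<times> cball z r)
       (\<lambda>n (s, z). \<Sum>m<n. of_nat (num_compositions N m) * (z + of_nat m) powr (- s))
       (\<lambda>(s, z). zeta_sum N s z) sequentially"
      by (rule uniform_limit_zeta_sum) (use s in auto)
    then show "uniform_limit (ball z r) ?f (zeta_sum N s) sequentially"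
      by (auto simp: uniform_limit_iff elim!: eventually_mono)
    show "\<forall>\<^sub>F n in sequentially. ?f n holomorphic_on ball z r"
      using der r by (intro always_eventually allI holomorphic_onI)
        (meson ball_subset_cball field_differentiable_at_within field_differentiable_def subsetD)
  qed (use r in auto)
  moreover have "deriv (?f n) z = - s * (\<Sum>m<n. of_nat (num_compositions N m)
      * (z + of_nat m) powr (- (s + 1)))" for n
    using DERIV_imp_deriv[OF der[OF z]] by (simp add: sum_distrib_left mult.left_commute)
  moreover have "(\<lambda>n. - s * (\<Sum>m<n. of_nat (num_compositions N m) * (z + of_nat m) powr (- (s + 1))))
     \<longlonglongrightarrow> - s * zeta_sum N (s + 1) z"
    unfolding zeta_sum_def by (intro tendsto_mult tendsto_const summable_LIMSEQ summable_zeta_sum)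
        (use s in auto)
  ultimately show ?thesis using LIMSEQ_unique by auto
qed

lemma has_field_derivative_zeta_sum:
  assumes "Re s > real N" "z \<in> slit_plane"
  shows "(zeta_sum N s has_field_derivative - s * zeta_sum N (s + 1) z) (at z)"
proof -
  have "zeta_sum N s holomorphic_on slit_plane"
    by (rule jointly_holomorphic_onD(3)[OF jointly_holomorphic_on_zeta_sum]) (use assms in auto)
  from holomorphic_derivI[OF this open_slit_plane assms(2), of UNIV] show ?thesis
    unfolding deriv_zeta_sum[OF assms] .
qed

lemma higher_deriv_zeta_sum:
  assumes "Re s > real N" "z \<in> slit_plane"
  shows "(deriv ^^ j) (zeta_sum N s) z = (-1) ^ j * pochhammer s j * zeta_sum N (s + of_nat j) z"
  using assms(2)
proof (induction j arbitrary: z)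
  case (Suc j)
  have "(deriv ^^ Suc j) (zeta_sum N s) z = deriv ((deriv ^^ j) (zeta_sum N s)) z"
    by simp
  also have "\<dots> = deriv (\<lambda>z. (-1) ^ j * pochhammer s j * zeta_sum N (s + of_nat j) z) z"
  proof (rule deriv_cong_ev)
    show "\<forall>\<^sub>F x in nhds z. (deriv ^^ j) (zeta_sum N s) x = (-1) ^ j * pochhammer s j
        * zeta_sum N (s + of_nat j) x"
      using eventually_nhds_in_open[OF open_slit_plane Suc.prems]
          by eventually_elim (use Suc.IH in auto)
  qed auto
  also have "\<dots> = (-1) ^ j * pochhammer s j * (- (s + of_nat j) * zeta_sum N (s + of_nat j + 1) z)"
    by (intro DERIV_imp_deriv DERIV_cmult has_field_derivative_zeta_sum) (use assms Suc in auto)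
  finally show ?case by (simp add: pochhammer_Suc algebra_simps)
qed auto

text \<open>
  Summation by parts: the weights of \<open>Z\<^bsub>N+1\<^esub>\<close> have the weights of \<open>Z\<^sub>N\<close> as differences.
\<close>
lemma zeta_sum_diff:
  assumes "Re s > real (Suc N)"
  shows "zeta_sum (Suc N) s z - zeta_sum (Suc N) s (z + 1) = zeta_sum N s z"
proof -
  let ?c = "\<lambda>m. (z + of_nat m) powr (- s)"
  let ?w = "num_compositions"
  define W where "W m = (of_nat (?w (Suc N) m) :: complex)" for m
  have W_Suc: "W (Suc m) = W m + of_nat (?w N (Suc m))" for m
    by (simp add: W_def)
  have W_0: "W 0 = of_nat (?w N 0)"
    by (simp add: W_def)
  have s1: "summable (\<lambda>m. W m * ?c m)"
    using summable_zeta_sum[OF assms] by (simp only: W_def)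
  have s2: "summable (\<lambda>m. W m * ?c (Suc m))"
    using summable_zeta_sum[OF assms, of "z + 1"] by (simp only: W_def of_nat_Suc add.assoc)
  have s3: "summable (\<lambda>m. of_nat (?w N m) * ?c m)"
    by (rule summable_zeta_sum) (use assms in simp)
  have "zeta_sum (Suc N) s (z + 1) = (\<Sum>m. W m * ?c (Suc m))"
    by (simp only: zeta_sum_def W_def of_nat_Suc add.assoc)
  moreover have "zeta_sum (Suc N) s z = (\<Sum>m. W (Suc m) * ?c (Suc m)) + W 0 * ?c 0"
    using suminf_split_head[OF s1] by (simp only: zeta_sum_def W_def diff_add_cancel)
  moreover have "zeta_sum N s z = (\<Sum>m. of_nat (?w N (Suc m)) * ?c (Suc m)) + W 0 * ?c 0"
    using suminf_split_head[OF s3] by (simp only: zeta_sum_def W_0 diff_add_cancel)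
  moreover have "(\<Sum>m. W (Suc m) * ?c (Suc m)) =
      (\<Sum>m. W m * ?c (Suc m)) + (\<Sum>m. of_nat (?w N (Suc m)) * ?c (Suc m))"
    using suminf_add[OF s2 summable_Suc_iff[THEN iffD2, OF s3]]
    by (simp only: W_Suc ring_distribs)
  ultimately show ?thesis by simp
qed

lemma zeta_sum_cnj:
  assumes "z \<in> slit_plane" "Re s > real N"
  shows "zeta_sum N (cnj s) (cnj z) = cnj (zeta_sum N s z)"
proof -
  have "(\<lambda>m. cnj (of_nat (num_compositions N m) * (z + of_nat m) powr (- s))) sums cnj (zeta_sum N s z)"
    unfolding sums_cnj zeta_sum_def by (rule summable_sums[OF summable_zeta_sum[OF assms(2)]])
  moreover have "cnj (of_nat (num_compositions N m) * (z + of_nat m) powr (- s))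
     = of_nat (num_compositions N m) * (cnj z + of_nat m) powr (- cnj s)" for m
    using slit_plane_add_nat[OF assms(1), of m]
    by (subst complex_cnj_mult, subst cnj_powr) (auto simp: complex_nonpos_Reals_iff)
  ultimately show ?thesis
    by (simp only: zeta_sum_def[of N "cnj s"] sums_iff)
qed

lemma zeta_sum_0: "zeta_sum 0 s z = z powr (- s)"
proof -
  have "zeta_sum 0 s z = (\<Sum>m\<in>{0}. of_nat (num_compositions 0 m) * (z + of_nat m) powr (- s))"
    unfolding zeta_sum_def by (rule suminf_finite) auto
  then show ?thesis by simp
qed

text \<open>
  Splitting off the last coordinate matches the recursion of \<^const>\<open>num_compositions\<close>.
\<close>
lemma card_compositions:
  "finite {x \<in> {..<N} \<rightarrow>\<^sub>E UNIV. (\<Sum>i<N. x i) = (k::nat)} \<and>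
   card {x \<in> {..<N} \<rightarrow>\<^sub>E UNIV. (\<Sum>i<N. x i) = (k::nat)} = num_compositions N k"
proof (induction N arbitrary: k)
  case 0
  have "{x \<in> {..<0::nat} \<rightarrow>\<^sub>E (UNIV :: nat set). (\<Sum>i<0. x i) = k}
      = (if k = 0 then {\<lambda>_. undefined} else {})"
    unfolding lessThan_0 PiE_empty_domain by auto
  then show ?case by (simp only:) simp
next
  case (Suc N)
  let ?F = "\<lambda>N k. {x \<in> {..<N} \<rightarrow>\<^sub>E (UNIV :: nat set). (\<Sum>i<N. x i) = k}"
  have fin: "finite (SIGMA i:{..k}. ?F N i)"
    using Suc by (intro finite_SigmaI) auto
  have bij: "bij_betw (\<lambda>(i, y). y(N := k - i)) (SIGMA i:{..k}. ?F N i) (?F (Suc N) k)"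
  proof (rule bij_betwI[where g = "\<lambda>x. (\<Sum>i<N. x i, restrict x {..<N})"])
    show "(\<lambda>(i, y). y(N := k - i)) \<in> (SIGMA i:{..k}. ?F N i) \<rightarrow> ?F (Suc N) k"
      by (auto simp: PiE_def extensional_def)
    show "(\<lambda>x. (\<Sum>i<N. x i, restrict x {..<N})) \<in> ?F (Suc N) k \<rightarrow> (SIGMA i:{..k}. ?F N i)"
      by auto
    show "(\<lambda>x. (\<Sum>i<N. x i, restrict x {..<N})) ((\<lambda>(i, y). y(N := k - i)) p) = p"
      if "p \<in> (SIGMA i:{..k}. ?F N i)" for p
      using that by (auto simp: PiE_def extensional_def fun_eq_iff restrict_def)
    show "(\<lambda>(i, y). y(N := k - i)) (\<Sum>i<N. x i, restrict x {..<N}) = x" if "x \<in> ?F (Suc N) k" for x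
      using that by (auto simp: PiE_def extensional_def fun_eq_iff restrict_def less_Suc_eq)
  qed
  have "card (?F (Suc N) k) = (\<Sum>i\<le>k. card (?F N i))"
    using bij_betw_same_card[OF bij] Suc by (simp add: card_SigmaI)
  then show ?case
    using bij_betw_finite[OF bij] fin Suc by simp
qed

lemma hurwitz_multiple_zeta_series_eq_zeta_sum:
  assumes "Re s > real N"
  shows "hurwitz_multiple_zeta_series N s z = zeta_sum N s z"
proof -
  define F where "F k = {x \<in> {..<N} \<rightarrow>\<^sub>E (UNIV :: nat set). (\<Sum>i<N. x i) = k}" for k
  define f where "f k = (z + of_nat k) powr (- s)" for k :: nat
  have F: "finite (F k)" "card (F k) = num_compositions N k" for k
    using card_compositions[of N k] by (auto simp: F_def)
  have bij: "bij_betw (\<lambda>x. (\<Sum>i<N. x i, x)) ({..<N} \<rightarrow>\<^sub>E UNIV) (Sigma UNIV F)"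
    by (rule bij_betwI[where g = snd]) (auto simp: F_def)
  have sn: "summable (\<lambda>k. norm (of_nat (num_compositions N k) * f k))"
    unfolding f_def by (rule summable_norm_zeta_sum[OF assms])
  have "(\<lambda>p. norm (case p of (k, x) \<Rightarrow> f k)) summable_on (Sigma UNIV F)"
    unfolding Infinite_Sum.abs_summable_on_Sigma_iff
  proof
    show "\<forall>k\<in>UNIV. (\<lambda>x. norm (case (k, x) of (k, x) \<Rightarrow> f k)) summable_on F k"
      using F by (simp add: summable_on_finite)
    have "(\<lambda>k. norm (of_nat (num_compositions N k) * f k)) summable_on UNIV"
      using sn by (simp add: summable_on_UNIV_nonneg_real_iff)
    then show "(\<lambda>k. norm (\<Sum>\<^sub>\<infinity>x\<in>F k. norm (case (k, x) of (k, x) \<Rightarrow> f k))) summable_on UNIV"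
      using F by (simp add: norm_mult)
  qed
  then have summ: "(\<lambda>(k, x). f k) summable_on (Sigma UNIV F)"
    by (rule Infinite_Sum.abs_summable_summable)
  have "hurwitz_multiple_zeta_series N s z = (\<Sum>\<^sub>\<infinity>x\<in>{..<N} \<rightarrow>\<^sub>E UNIV. (\<lambda>(k, x). f k) (\<Sum>i<N. x i, x))"
    by (simp add: hurwitz_multiple_zeta_series_def f_def)
  also have "\<dots> = (\<Sum>\<^sub>\<infinity>(k, x)\<in>Sigma UNIV F. f k)"
    by (rule infsum_reindex_bij_betw[OF bij])
  also have "\<dots> = (\<Sum>\<^sub>\<infinity>k. \<Sum>\<^sub>\<infinity>x\<in>F k. f k)"
    using infsum_Sigma'_banach[OF summ] by simp
  also have "\<dots> = (\<Sum>\<^sub>\<infinity>k. of_nat (num_compositions N k) * f k)"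
    using F by simp
  also have "\<dots> = (\<Sum>k. of_nat (num_compositions N k) * f k)"
    by (rule infsumI[OF norm_summable_imp_has_sum[OF sn summable_sums[OF summable_norm_cancel[OF sn]]]])
  finally show ?thesis by (simp add: zeta_sum_def f_def)
qed

section \<open>Continuation in the exponent\<close>

text \<open>
  The product \<open>(s - 1) \<dots> (s - N)\<close>, which clears the poles of the continued series.
\<close>
definition pole_factor :: "nat \<Rightarrow> complex \<Rightarrow> complex" where
  "pole_factor N s = pochhammer (s - of_nat N) N"

lemma pole_factor_Suc: "pole_factor (Suc N) s = pole_factor N (s - 1) * (s - 1)"
  by (simp add: pole_factor_def pochhammer_Suc algebra_simps)

lemma pole_factor_shift: "s * pole_factor N s = (s - of_nat N) * pole_factor N (s + 1)"
  using pochhammer_Suc[of "s - of_nat N" N] pochhammer_rec[of "s - of_nat N" N]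
  by (simp add: pole_factor_def algebra_simps)

lemma holomorphic_on_pochhammer [holomorphic_intros]:
  "f holomorphic_on A \<Longrightarrow> (\<lambda>s. pochhammer (f s) n) holomorphic_on A"
  by (induction n) (auto simp: pochhammer_Suc intro!: holomorphic_intros)

lemma holomorphic_on_pole_factor: "pole_factor N holomorphic_on A"
  unfolding pole_factor_def[abs_def] by (intro holomorphic_intros)

lemma pole_factor_eq_0_iff: "pole_factor N s = 0 \<longleftrightarrow> s \<in> of_nat ` {1..N}"
proof
  assume "pole_factor N s = 0"
  then obtain k where k: "k < N" "s - of_nat N = - of_nat k"
    by (auto simp: pole_factor_def pochhammer_eq_0_iff)
  then have "s = of_nat (N - k)" by (simp add: of_nat_diff algebra_simps)
  then show "s \<in> of_nat ` {1..N}" using k(1) by (intro image_eqI[of _ _ "N - k"]) auto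
next
  assume "s \<in> of_nat ` {1..N}"
  then obtain i where "s = of_nat i" "1 \<le> i" "i \<le> N" by auto
  then show "pole_factor N s = 0"
    unfolding pole_factor_def pochhammer_eq_0_iff
    by (intro exI[of _ "N - i"]) (auto simp: of_nat_diff)
qed

text \<open>
  The right-hand side involves \<open>Z\<^bsub>N+1\<^esub>\<close> only at \<open>s + 1\<close>, so the identity can serve as a definition of
  \<open>Z\<^bsub>N+1\<^esub>\<close> further to the left. The bound \<open>N + 2\<close> ensures that \<open>Z\<^bsub>N+1\<^esub>(s - 1, \<cdot>)\<close>, which occurs in
  the proof, converges.
\<close>
lemma zeta_sum_recurrence:
  assumes s: "Re s > real N + 2" and z: "z \<in> slit_plane"
  shows "(s - 1) * zeta_sum (Suc N) s z = zeta_sum N (s - 1) z +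
     (s - 1) * s * integral {0..1} (\<lambda>u. (1 - of_real u) * zeta_sum (Suc N) (s + 1) (z + of_real u))"
proof -
  let ?Z = "zeta_sum (Suc N)"
  \<comment> \<open>The second summand cancels the term of the derivative of the first that contains \<open>Z\<close> at \<open>s\<close>
      itself.\<close>
  define \<Phi> where "\<Phi> u = (s - 1) * (1 - u) * ?Z s (z + u) - ?Z (s - 1) (z + u)" for u :: complex
  have der: "(\<Phi> has_field_derivative (- ((s - 1) * s)
      * ((1 - of_real u) * ?Z (s + 1) (z + of_real u)))) (at (of_real u))"
    if u: "u \<in> {0..1}" for u
  proof -
    have zu: "z + of_real u \<in> slit_plane" using u z by (intro slit_plane_add_real) auto
    have d: "((\<lambda>u. ?Z s' (z + u)) has_field_derivative - s' * ?Z (s' + 1) (z + of_real u))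
        (at (of_real u))"
      if "Re s' > real (Suc N)" for s'
    proof -
      have "((\<lambda>u. z + u) has_field_derivative 1) (at (of_real u))"
        by (auto intro!: derivative_eq_intros)
      from DERIV_chain2[where f = "?Z s'" and g = "\<lambda>u. z + u", OF
          has_field_derivative_zeta_sum[OF that zu] this]
      show ?thesis by simp
    qed
    have d1: "((\<lambda>u. ?Z s (z + u)) has_field_derivative - s * ?Z (s + 1) (z + of_real u))
        (at (of_real u))"
      by (rule d) (use s in simp)
    have d2: "((\<lambda>u. ?Z (s - 1) (z + u)) has_field_derivative - (s - 1)
        * ?Z (s - 1 + 1) (z + of_real u)) (at (of_real u))"
      by (rule d) (use s in simp)
    show ?thesis unfolding \<Phi>_def
      by (rule derivative_eq_intros d1 d2 refl)+ (simp add: algebra_simps)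
  qed
  have "((\<lambda>u. - ((s - 1) * s) * ((1 - of_real u) * ?Z (s + 1) (z + of_real u))) has_integral
      (\<Phi> (of_real 1) - \<Phi> (of_real 0))) {0..1}"
  proof (rule fundamental_theorem_of_calculus)
    fix u :: real assume "u \<in> {0..1}"
    from has_vector_derivative_real_field[OF der[OF this]]
    show "((\<lambda>u. \<Phi> (of_real u)) has_vector_derivative
       - ((s - 1) * s) * ((1 - of_real u) * ?Z (s + 1) (z + of_real u))) (at u within {0..1})"
      by (auto intro: has_vector_derivative_at_within)
  qed auto
  then have "integral {0..1} (\<lambda>u. - ((s - 1) * s) * ((1 - of_real u) * ?Z (s + 1) (z + of_real u)))
      = \<Phi> 1 - \<Phi> 0"
    by (simp only: integral_unique of_real_0 of_real_1)
  moreover have "\<Phi> 1 - \<Phi> 0 = zeta_sum N (s - 1) z - (s - 1) * ?Z s z"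
    using zeta_sum_diff[of N "s - 1" z] s by (simp add: \<Phi>_def)
  ultimately have "- ((s - 1) * s) * integral {0..1} (\<lambda>u. ((1 - of_real u)
      * ?Z (s + 1) (z + of_real u)))
     = zeta_sum N (s - 1) z - (s - 1) * ?Z s z"
    by simp
  then show ?thesis by (simp add: algebra_simps)
qed

lemma jointly_holomorphic_on_UN:
  assumes "\<And>j. jointly_holomorphic_on V (S j) Z" "\<And>j. open (S j)" "open Z"
  shows "jointly_holomorphic_on V (\<Union>j. S j) Z"
proof (rule jointly_holomorphic_onI)
  have "continuous_on (\<Union>j. S j \<times> Z) (\<lambda>(s, z). V s z)"
    by (rule continuous_on_open_UN)
       (use assms in \<open>auto intro: open_Times jointly_holomorphic_onD(1)\<close>)
  then show "continuous_on ((\<Union>j. S j) \<times> Z) (\<lambda>(s, z). V s z)"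
    by (simp add: Sigma_Union UN_extend_simps)
next
  fix z assume "z \<in> Z"
  then show "(\<lambda>s. V s z) holomorphic_on (\<Union>j. S j)"
    using assms by (intro holomorphic_on_UN_open jointly_holomorphic_onD(2)) auto
next
  fix s assume "s \<in> (\<Union>j. S j)"
  then show "V s holomorphic_on Z" using jointly_holomorphic_onD(3)[OF assms(1)] by auto
qed

text \<open>
  For \<open>X s z = (s - 1) \<dots> (s - N - 1) Z\<^bsub>N+1\<^esub>(s, z)\<close>, and \<open>Y\<close> the corresponding function for \<open>N\<close>,
  \<open>zeta_sum_recurrence\<close> reads
  \<open>X s z = Y (s - 1) z + (s - N - 1) \<integral>\<^sub>0\<^sup>1 (1 - u) X (s + 1) (z + u) du\<close>.
  Each use of it moves the boundary of the half-plane one unit to the left.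
\<close>
lemma ex_zeta_continuation_step:
  assumes Y: "jointly_holomorphic_on Y UNIV slit_plane"
      "\<And>s z. Re s > real N \<Longrightarrow> z \<in> slit_plane \<Longrightarrow> Y s z = pole_factor N s * zeta_sum N s z"
  shows "\<exists>X. jointly_holomorphic_on X {s. Re s > real (Suc N) - real j} slit_plane \<and>
     (\<forall>s z. Re s > real (Suc N) \<longrightarrow> z \<in> slit_plane \<longrightarrow>
        X s z = pole_factor (Suc N) s * zeta_sum (Suc N) s z)"
proof (induction j)
  case 0
  show ?case
    by (rule exI[of _ "\<lambda>s z. pole_factor (Suc N) s * zeta_sum (Suc N) s z"])
       (use jointly_holomorphic_on_zeta_sum[of "Suc N"] in
         \<open>auto intro!: jointly_holomorphic_on_mult jointly_holomorphic_on_left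
             holomorphic_on_pole_factor\<close>)
next
  case (Suc j)
  then obtain X where X: "jointly_holomorphic_on X {s. Re s > real (Suc N) - real j} slit_plane"
     "\<And>s z. Re s > real (Suc N) \<Longrightarrow> z \<in> slit_plane \<Longrightarrow>
        X s z = pole_factor (Suc N) s * zeta_sum (Suc N) s z" by blast
  define S where "S = {s. Re s > real (Suc N) - real (Suc j)}"
  define I where "I s z = integral {0..1} (\<lambda>u. (1 - of_real u) * X (s + 1) (z + of_real u))" for s z
  define X' where "X' s z = Y (s - 1) z + (s - of_nat (Suc N)) * I s z" for s z
  have X': "jointly_holomorphic_on X' S slit_plane"
    unfolding X'_def I_def
  proof (intro jointly_holomorphic_on_add jointly_holomorphic_on_mult jointly_holomorphic_on_integral
            jointly_holomorphic_on_left)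
    show "jointly_holomorphic_on (\<lambda>s. Y (s - 1)) S slit_plane"
      by (rule jointly_holomorphic_on_compose[OF Y(1), of "\<lambda>s. s - 1" _ "\<lambda>z. z"])
         (auto intro!: holomorphic_intros)
    show "jointly_holomorphic_on (\<lambda>s. X (s + 1)) S slit_plane"
      by (rule jointly_holomorphic_on_compose[OF X(1), of "\<lambda>s. s + 1" _ "\<lambda>z. z"])
         (auto intro!: holomorphic_intros simp: S_def)
    show "open S" unfolding S_def by (rule open_halfplane_Re_gt)
  qed (use slit_plane_add_real in \<open>auto intro!: open_slit_plane continuous_intros holomorphic_intros\<close>)
  have far: "X' s z = pole_factor (Suc N) s * zeta_sum (Suc N) s z"
    if s: "Re s > real (Suc N) + 1" and z: "z \<in> slit_plane" for s z
  proof -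
    let ?J = "integral {0..1} (\<lambda>u. (1 - of_real u) * zeta_sum (Suc N) (s + 1) (z + of_real u))"
    have "I s z = integral {0..1} (\<lambda>u. pole_factor (Suc N) (s + 1) *
                    ((1 - of_real u) * zeta_sum (Suc N) (s + 1) (z + of_real u)))"
      unfolding I_def
    proof (rule integral_cong)
      fix u :: real assume "u \<in> {0..1}"
      then have "z + of_real u \<in> slit_plane" using z by (intro slit_plane_add_real) auto
      then show "(1 - of_real u) * X (s + 1) (z + of_real u) = pole_factor (Suc N) (s + 1) *
                    ((1 - of_real u) * zeta_sum (Suc N) (s + 1) (z + of_real u))"
        using X(2)[of "s + 1" "z + of_real u"] s by simp
    qed
    then have I: "I s z = pole_factor (Suc N) (s + 1) * ?J" by simp
    have "pole_factor (Suc N) s * zeta_sum (Suc N) s z =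
            pole_factor N (s - 1) * ((s - 1) * zeta_sum (Suc N) s z)"
      by (simp add: pole_factor_Suc)
    also have "\<dots> = pole_factor N (s - 1) * zeta_sum N (s - 1) z + s * pole_factor (Suc N) s * ?J"
      by (subst zeta_sum_recurrence) (use s z in \<open>simp_all add: pole_factor_Suc algebra_simps\<close>)
    also have "\<dots> = X' s z"
      unfolding X'_def I pole_factor_shift using Y(2)[of "s - 1" z] s z by simp
    finally show ?thesis by simp
  qed
  have "X' s z = pole_factor (Suc N) s * zeta_sum (Suc N) s z"
    if s: "Re s > real (Suc N)" and z: "z \<in> slit_plane" for s z
  proof (rule analytic_continuation_open[of "{s. Re s > real (Suc N) + 1}" "{s. Re s > real (Suc N)}"
        "\<lambda>s. X' s z" "\<lambda>s. pole_factor (Suc N) s * zeta_sum (Suc N) s z"])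
    show "{s. Re s > real (Suc N) + 1} \<noteq> {}"
      by (auto intro!: exI[of _ "of_real (real (Suc N) + 2)"])
    show "connected {s. Re s > real (Suc N)}"
      by (intro convex_connected convex_halfspace_Re_gt)
    show "(\<lambda>s. X' s z) holomorphic_on {s. Re s > real (Suc N)}"
      using jointly_holomorphic_onD(2)[OF X' z] by (rule holomorphic_on_subset) (auto simp: S_def)
    show "(\<lambda>s. pole_factor (Suc N) s * zeta_sum (Suc N) s z) holomorphic_on {s. Re s > real (Suc N)}"
      by (intro holomorphic_intros holomorphic_on_pole_factor z
            jointly_holomorphic_onD(2)[OF jointly_holomorphic_on_zeta_sum])
  qed (use far s z in \<open>auto intro: open_halfplane_Re_gt\<close>)
  with X' show ?case unfolding S_def by blast
qed

text \<open>
  The continuations to the half-planes \<open>Re s > N - j\<close> agree by the identity theorem and are glued.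
\<close>
lemma ex_zeta_continuation:
  "\<exists>Y. jointly_holomorphic_on Y UNIV slit_plane \<and>
     (\<forall>s z. Re s > real N \<longrightarrow> z \<in> slit_plane \<longrightarrow> Y s z = pole_factor N s * zeta_sum N s z)"
proof (induction N)
  case 0
  show ?case
    by (rule exI[of _ "\<lambda>s z. z powr (- s)"])
       (simp add: jointly_holomorphic_on_powr zeta_sum_0 pole_factor_def)
next
  case (Suc N)
  define S where "S j = {s. Re s > real (Suc N) - real j}" for j
  have S: "open (S j)" "connected (S j)" for j
    unfolding S_def by (rule open_halfplane_Re_gt, intro convex_connected convex_halfspace_Re_gt)
  from Suc obtain Y where "jointly_holomorphic_on Y UNIV slit_plane"
      "\<And>s z. Re s > real N \<Longrightarrow> z \<in> slit_plane \<Longrightarrow> Y s z = pole_factor N s * zeta_sum N s z"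
    by blast
  from ex_zeta_continuation_step[OF this]
  have "\<forall>j. \<exists>X. jointly_holomorphic_on X (S j) slit_plane \<and>
     (\<forall>s z. Re s > real (Suc N) \<longrightarrow> z \<in> slit_plane \<longrightarrow>
        X s z = pole_factor (Suc N) s * zeta_sum (Suc N) s z)"
    unfolding S_def by blast
  then obtain X where X: "\<And>j. jointly_holomorphic_on (X j) (S j) slit_plane"
     "\<And>j s z. Re s > real (Suc N) \<Longrightarrow> z \<in> slit_plane \<Longrightarrow>
        X j s z = pole_factor (Suc N) s * zeta_sum (Suc N) s z"
    by metis
  have agree: "X i s z = X j s z" if "i \<le> j" "s \<in> S i" "z \<in> slit_plane" for i j s z
  proof (rule analytic_continuation_open[of "S 0" "S i" "\<lambda>s. X i s z" "\<lambda>s. X j s z"])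
    show "S 0 \<noteq> {}" by (auto simp: S_def intro!: exI[of _ "of_real (real (Suc N) + 1)"])
    show "(\<lambda>s. X i s z) holomorphic_on S i"
      by (rule jointly_holomorphic_onD(2)[OF X(1)]) fact
    show "(\<lambda>s. X j s z) holomorphic_on S i"
      using jointly_holomorphic_onD(2)[OF X(1) that(3)] by (rule holomorphic_on_subset)
        (use that in \<open>auto simp: S_def\<close>)
    show "S 0 \<subseteq> S i" by (auto simp: S_def)
    show "X i w z = X j w z" if "w \<in> S 0" for w
      using X(2)[of w z] that \<open>z \<in> slit_plane\<close> by (simp add: S_def)
  qed (use that S in auto)
  \<comment> \<open>A half-plane containing \<open>s\<close>; by \<open>agree\<close> any other choice gives the same value.\<close>
  define m where "m s = nat \<lceil>real (Suc N) - Re s\<rceil> + 1" for s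
  have m: "s \<in> S (m s)" for s unfolding S_def m_def by simp linarith
  have eq: "X (m s) s z = X j s z" if "s \<in> S j" "z \<in> slit_plane" for s j z
  proof (cases "j \<le> m s")
    case True
    from agree[OF this that] show ?thesis by (rule sym)
  next
    case False
    then show ?thesis by (intro agree m that) simp
  qed
  have "jointly_holomorphic_on (\<lambda>s z. X (m s) s z) (\<Union>j. S j) slit_plane"
  proof (rule jointly_holomorphic_on_UN)
    show "jointly_holomorphic_on (\<lambda>s z. X (m s) s z) (S j) slit_plane" for j
      using X(1)[of j] by (rule jointly_holomorphic_on_cong) (use eq in auto)
  qed (use S open_slit_plane in auto)
  moreover have "(\<Union>j. S j) = UNIV" using m by auto
  ultimately show ?case using X(2) by (intro exI[of _ "\<lambda>s z. X (m s) s z"]) auto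
qed

text \<open>
  The entire function \<open>s \<mapsto> (s - 1) \<dots> (s - N) Z\<^sub>N(s, z)\<close>. For \<open>z\<close> in the slit plane it is determined
  by the two conditions.
\<close>
definition zeta_ext :: "nat \<Rightarrow> complex \<Rightarrow> complex \<Rightarrow> complex" where
  "zeta_ext N = (SOME Y. jointly_holomorphic_on Y UNIV slit_plane \<and>
     (\<forall>s z. Re s > real N \<longrightarrow> z \<in> slit_plane \<longrightarrow> Y s z = pole_factor N s * zeta_sum N s z))"

lemma jointly_holomorphic_on_zeta_ext: "jointly_holomorphic_on (zeta_ext N) UNIV slit_plane"
  and zeta_ext_eq: "Re s > real N \<Longrightarrow> z \<in> slit_plane \<Longrightarrow> zeta_ext N s z = pole_factor N s * zeta_sum N s z"
  using someI_ex[OF ex_zeta_continuation[of N]] unfolding zeta_ext_def[symmetric] by auto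

section \<open>The logarithm of the multiple gamma function\<close>

text \<open>
  The difference vanishes on an open set, hence off a sparse set. At the remaining points either both
  functions have a pole, with the value \<open>0\<close>, or both are equal to their common limit.
\<close>
lemma nicely_meromorphic_on_unique:
  assumes F: "F nicely_meromorphic_on UNIV" and G: "G nicely_meromorphic_on UNIV"
    and eq: "open S" "w \<in> S" "\<And>s. s \<in> S \<Longrightarrow> F s = G s"
  shows "F = G"
proof
  fix z
  have mero: "F meromorphic_on UNIV" "G meromorphic_on UNIV"
    using F G by (auto simp: nicely_meromorphic_on_def)
  have "(\<lambda>s. F s - G s) meromorphic_on UNIV"
    by (intro meromorphic_intros mero)
  then consider "\<forall>\<^sub>\<approx>s\<in>UNIV. F s - G s = 0" | "\<forall>\<^sub>\<approx>s\<in>UNIV. F s - G s \<noteq> 0"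
    using meromorphic_imp_constant_or_avoid[of "\<lambda>s. F s - G s" UNIV 0] by auto
  then have ev: "\<forall>\<^sub>F s in at z. F s = G s" for z
  proof cases
    case 1
    then show ?thesis
      using eventually_cosparse_imp_eventually_at[OF 1, of z UNIV] by simp
  next
    case 2
    have "\<forall>\<^sub>F s in at w. F s - G s \<noteq> 0"
      using eventually_cosparse_imp_eventually_at[OF 2, of w UNIV] by simp
    moreover have "\<forall>\<^sub>F s in at w. s \<in> S"
      using eq(1,2) by (rule eventually_at_in_open')
    ultimately have "\<forall>\<^sub>F s in at w. False"
      by eventually_elim (use eq(3) in auto)
    then show ?thesis by simp
  qed
  show "F z = G z"
  proof (cases "is_pole F z")
    case True
    then have "is_pole G z" using is_pole_cong[OF ev refl] by blast
    then show ?thesis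
      using is_pole_zero_at_nicely_mero[OF F True] is_pole_zero_at_nicely_mero[OF G] by simp
  next
    case False
    then have "\<not> is_pole G z" using is_pole_cong[OF ev refl] by blast
    then have "F \<midarrow>z\<rightarrow> F z" "G \<midarrow>z\<rightarrow> G z"
      using F G False by (auto simp: nicely_meromorphic_on_def)
    moreover have "F \<midarrow>z\<rightarrow> G z"
      using \<open>G \<midarrow>z\<rightarrow> G z\<close> by (rule Lim_transform_eventually)
          (use ev[of z] in \<open>auto elim: eventually_mono\<close>)
    ultimately show ?thesis by (metis LIM_unique)
  qed
qed

lemma hurwitz_multiple_zeta_eq:
  assumes z: "z \<in> slit_plane" and s: "pole_factor N s \<noteq> 0"
  shows "hurwitz_multiple_zeta N s z = zeta_ext N s z / pole_factor N s"
proof -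
  define G where "G s = zeta_ext N s z / pole_factor N s" for s
  define Z where "Z = remove_sings G"
  have an: "(\<lambda>s. zeta_ext N s z) analytic_on UNIV" "pole_factor N analytic_on UNIV"
    using jointly_holomorphic_onD(2)[OF jointly_holomorphic_on_zeta_ext z]
      holomorphic_on_pole_factor[of N UNIV] by (auto simp: analytic_on_open)
  then have "G meromorphic_on UNIV"
    unfolding G_def by (intro meromorphic_intros analytic_on_imp_meromorphic_on)
  then have nice: "Z nicely_meromorphic_on UNIV"
    unfolding Z_def by (rule remove_sings_nicely_meromorphic)
  have ZG: "Z s = G s" if "pole_factor N s \<noteq> 0" for s
  proof -
    have "G analytic_on {s}"
      unfolding G_def using that an
      by (intro analytic_intros analytic_on_subset[of _ UNIV "{s}"]) auto
    then show ?thesis by (simp add: Z_def)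
  qed
  have Z_series: "Z s = hurwitz_multiple_zeta_series N s z" if "Re s > real N" for s
  proof -
    have "pole_factor N s \<noteq> 0" using that by (auto simp: pole_factor_eq_0_iff)
    then show ?thesis
      using ZG[of s] that z
      by (simp add: G_def zeta_ext_eq hurwitz_multiple_zeta_series_eq_zeta_sum)
  qed
  have "(THE F. F nicely_meromorphic_on UNIV \<and>
          (\<forall>s. Re s > real N \<longrightarrow> F s = hurwitz_multiple_zeta_series N s z)) = Z"
  proof (rule the_equality)
    fix F assume "F nicely_meromorphic_on UNIV \<and>
          (\<forall>s. Re s > real N \<longrightarrow> F s = hurwitz_multiple_zeta_series N s z)"
    then show "F = Z"
      using Z_series nice
      by (intro nicely_meromorphic_on_unique[OF _ _ open_halfplane_Re_gt[of "real N"],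
            of _ _ "of_real (real N + 1)"]) auto
  qed (use nice Z_series in auto)
  then show ?thesis
    unfolding hurwitz_multiple_zeta_def using ZG[OF s] by (simp add: G_def)
qed

text \<open>
  Since \<^const>\<open>pole_factor\<close> does not vanish near \<open>0\<close>, this is the derivative at \<open>0\<close> of the continued
  zeta function.
\<close>
definition log_barnes_Gamma :: "nat \<Rightarrow> complex \<Rightarrow> complex" where
  "log_barnes_Gamma N z = deriv (\<lambda>s. zeta_ext N s z / pole_factor N s) 0"

lemma pole_factor_nonzero_near_0: "s \<in> ball 0 1 \<Longrightarrow> pole_factor N s \<noteq> 0"
  by (auto simp: pole_factor_eq_0_iff)

lemma jointly_holomorphic_on_zeta_near_0:
  "jointly_holomorphic_on (\<lambda>s z. zeta_ext N s z / pole_factor N s) (ball 0 1) slit_plane"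
proof -
  have "jointly_holomorphic_on (\<lambda>s z. inverse (pole_factor N s) * zeta_ext N s z) (ball 0 1) slit_plane"
    by (intro jointly_holomorphic_on_mult jointly_holomorphic_on_left holomorphic_intros
          holomorphic_on_pole_factor pole_factor_nonzero_near_0
          jointly_holomorphic_on_subset[OF jointly_holomorphic_on_zeta_ext]) auto
  then show ?thesis by (simp add: field_simps)
qed

lemma barnes_Gamma_eq_exp:
  assumes z: "z \<in> slit_plane"
  shows "barnes_Gamma N z = exp (log_barnes_Gamma N z)"
proof -
  have "deriv (\<lambda>s. hurwitz_multiple_zeta N s z) 0 = log_barnes_Gamma N z"
    unfolding log_barnes_Gamma_def
  proof (rule deriv_cong_ev)
    have "\<forall>\<^sub>F s in nhds 0. s \<in> ball (0::complex) 1"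
      by (rule eventually_nhds_in_open) auto
    then show "\<forall>\<^sub>F s in nhds 0. hurwitz_multiple_zeta N s z = zeta_ext N s z / pole_factor N s"
      by eventually_elim (use hurwitz_multiple_zeta_eq[OF z] pole_factor_nonzero_near_0 in blast)
  qed auto
  then show ?thesis
    using z nonpos_Ints_subset_nonpos_Reals by (auto simp: barnes_Gamma_def)
qed

lemma holomorphic_on_log_barnes_Gamma: "log_barnes_Gamma N holomorphic_on slit_plane"
  unfolding log_barnes_Gamma_def[abs_def]
  by (rule holomorphic_on_deriv_param[OF jointly_holomorphic_on_zeta_near_0])
     (auto intro: open_slit_plane)

text \<open>
  The symmetry of the series for \<open>Re s > N\<close> extends by the identity theorem, applied to the
  holomorphic function \<open>s \<mapsto> cnj (zeta_ext N (cnj s) (cnj z))\<close>.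
\<close>
lemma zeta_ext_cnj:
  assumes z: "z \<in> slit_plane"
  shows "zeta_ext N (cnj s) (cnj z) = cnj (zeta_ext N s z)"
proof -
  have cz: "cnj z \<in> slit_plane" using z by (auto simp: complex_nonpos_Reals_iff)
  let ?f = "\<lambda>s. zeta_ext N s z" and ?g = "cnj \<circ> (\<lambda>s. zeta_ext N s (cnj z)) \<circ> cnj"
  have "?f s = ?g s"
  proof (rule analytic_continuation_open[of "{s. Re s > real N}" UNIV ?f ?g])
    show "{s. Re s > real N} \<noteq> {}" by (auto intro!: exI[of _ "of_real (real N + 1)"])
    show "?f holomorphic_on UNIV"
      by (rule jointly_holomorphic_onD(2)[OF jointly_holomorphic_on_zeta_ext z])
    show "?g holomorphic_on UNIV"
      by (rule holomorphic_on_compose_cnj_cnj, rule holomorphic_on_subset,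
          rule jointly_holomorphic_onD(2)[OF jointly_holomorphic_on_zeta_ext cz]) auto
    show "?f s = ?g s" if "s \<in> {s. Re s > real N}" for s
    proof -
      have "zeta_ext N (cnj s) (cnj z) = pole_factor N (cnj s) * zeta_sum N (cnj s) (cnj z)"
        by (rule zeta_ext_eq) (use that cz in auto)
      also have "\<dots> = cnj (pole_factor N s * zeta_sum N s z)"
        using zeta_sum_cnj[OF z, of N s] that by (simp add: pole_factor_def)
      also have "\<dots> = cnj (zeta_ext N s z)"
        using zeta_ext_eq[of N s z] that z by simp
      finally show ?thesis by simp
    qed
  qed (auto intro: open_halfplane_Re_gt)
  then show ?thesis by simp
qed

lemma log_barnes_Gamma_real:
  assumes "x > 0"
  shows "log_barnes_Gamma N (of_real x) \<in> \<real>"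
proof -
  let ?q = "\<lambda>s. zeta_ext N s (of_real x) / pole_factor N s"
  have x: "of_real x \<in> slit_plane" using assms by auto
  have "(?q has_field_derivative log_barnes_Gamma N (of_real x)) (at 0)"
    unfolding log_barnes_Gamma_def
    by (rule holomorphic_derivI[OF jointly_holomorphic_onD(2)[OF jointly_holomorphic_on_zeta_near_0
        x]]) auto
  then have "(cnj \<circ> ?q \<circ> cnj has_field_derivative cnj (log_barnes_Gamma N (of_real x))) (at 0)"
    by (intro has_field_derivative_cnj_cnj) simp
  moreover have "cnj \<circ> ?q \<circ> cnj = ?q"
    using zeta_ext_cnj[OF x] by (auto simp: fun_eq_iff pole_factor_def)
  ultimately have "cnj (log_barnes_Gamma N (of_real x)) = log_barnes_Gamma N (of_real x)"
    using DERIV_imp_deriv[of ?q] log_barnes_Gamma_def by metis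
  then show ?thesis by (simp add: Reals_cnj_iff)
qed

text \<open>
  The difference of two branches has derivative \<open>0\<close> on the slit plane, which is connected, so it is a
  constant; at \<open>1\<close> it is a real number whose exponential is \<open>1\<close>.
\<close>
lemma log_branch_eq:
  assumes M: "M holomorphic_on slit_plane" "\<And>z. z \<in> slit_plane \<Longrightarrow> exp (M z) = f z"
    "\<And>x. x > 0 \<Longrightarrow> M (of_real x) \<in> \<real>" and z: "z \<in> slit_plane"
  shows "log_branch f z = M z"
proof -
  define L where "L = log_branch f"
  have "\<exists>L. L holomorphic_on slit_plane \<and> (\<forall>z\<in>slit_plane. exp (L z) = f z) \<and>
          (\<forall>x::real. x > 0 \<longrightarrow> L (of_real x) \<in> \<real>)"
    using M by (intro exI[of _ M]) auto
  from someI_ex[OF this]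
  have "L holomorphic_on slit_plane \<and> (\<forall>z\<in>slit_plane. exp (L z) = f z) \<and>
          (\<forall>x::real. x > 0 \<longrightarrow> L (of_real x) \<in> \<real>)"
    unfolding L_def log_branch_def .
  then have L: "L holomorphic_on slit_plane" "\<And>z. z \<in> slit_plane \<Longrightarrow> exp (L z) = f z"
    "\<And>x::real. x > 0 \<Longrightarrow> L (of_real x) \<in> \<real>" by auto
  define D where "D z = L z - M z" for z
  have expD: "exp (D z) = 1" if "z \<in> slit_plane" for z
    unfolding D_def exp_diff L(2)[OF that] M(2)[OF that, symmetric] by simp
  have "D constant_on slit_plane"
  proof (rule has_field_derivative_0_imp_constant_on[OF _ _ open_slit_plane])
    have "slit_plane = - (complex_of_real ` {..0})"
      by (auto simp: nonpos_Reals_def)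
    then show "connected slit_plane"
      using starlike_slotted_complex_plane_left starlike_imp_connected by metis
    fix z assume z: "z \<in> slit_plane"
    have d: "(D has_field_derivative deriv D z) (at z)"
      by (rule holomorphic_derivI[OF _ open_slit_plane z])
         (unfold D_def[abs_def], intro holomorphic_intros L M)
    have "((\<lambda>z. exp (D z)) has_field_derivative exp (D z) * deriv D z) (at z)"
      by (auto intro!: derivative_eq_intros d)
    moreover have "((\<lambda>z. exp (D z)) has_field_derivative 0) (at z)"
      by (rule has_field_derivative_transform_within_open[of "\<lambda>_. 1" _ _ slit_plane])
         (use expD z open_slit_plane in auto)
    ultimately have "deriv D z = 0"
      using DERIV_unique[OF _ \<open>((\<lambda>z. exp (D z)) has_field_derivative 0) (at z)\<close>] by force
    with d show "(D has_field_derivative 0) (at z)" by simp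
  qed
  then obtain c where c: "\<And>z. z \<in> slit_plane \<Longrightarrow> D z = c" by (auto simp: constant_on_def)
  have "D 1 \<in> \<real>" unfolding D_def using L(3)[of 1] M(3)[of 1] by auto
  then obtain x where x: "D 1 = of_real x" by (auto elim: Reals_cases)
  have "exp (complex_of_real x) = 1" using expD[of 1] x by simp
  then have "complex_of_real (exp x) = 1" by (simp add: exp_of_real)
  then have "x = 0" by (simp only: of_real_eq_1_iff exp_eq_one_iff)
  then have "c = 0" using c[of 1] x by simp
  then show ?thesis using c[OF z] by (simp add: D_def L_def)
qed

lemma log_branch_inverse_barnes_Gamma:
  assumes "z \<in> slit_plane"
  shows "log_branch (\<lambda>w. 1 / barnes_Gamma N w) z = - log_barnes_Gamma N z"
  by (rule log_branch_eq)
     (use assms log_barnes_Gamma_real in \<open>auto intro!: holomorphic_intros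
         holomorphic_on_log_barnes_Gamma
        simp: barnes_Gamma_eq_exp exp_minus field_simps\<close>)

section \<open>Exponential integrals\<close>

lemma tendsto_power_mult_exp_neg:
  assumes "x > (0::real)"
  shows "((\<lambda>s. s ^ k * exp (- (s * x))) \<longlongrightarrow> 0) at_top"
proof -
  have "filterlim (\<lambda>s. s * x) at_top at_top"
    using filterlim_tendsto_pos_mult_at_top[OF tendsto_const assms filterlim_ident]
        by (simp add: mult.commute)
  from filterlim_compose[OF tendsto_power_div_exp_0[of k] this]
  have "((\<lambda>s. (s * x) ^ k / exp (s * x) / x ^ k) \<longlongrightarrow> 0 / x ^ k) at_top"
    using assms by (intro tendsto_divide tendsto_const) auto
  then show ?thesis
    using assms by (simp add: power_mult_distrib exp_minus field_simps)
qed

text \<open>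
  Integration by parts, phrased so that it applies to real and to complex \<open>w\<close>: the real case yields the
  integrability that the fundamental theorem for the complex case requires.
\<close>
lemma ex_antiderivative_power_mult_exp:
  fixes w :: "'a :: {real_normed_field, banach}"
  assumes w: "w \<noteq> 0"
    and lim: "\<And>k. ((\<lambda>s. of_real s ^ k * exp (- (of_real s * w))) \<longlongrightarrow> 0) at_top"
  shows "\<exists>F. (\<forall>s. (F has_field_derivative s ^ N * exp (- (s * w))) (at s)) \<and>
     F 0 = - (fact N / w ^ (N + 1)) \<and> ((\<lambda>s. F (of_real s)) \<longlongrightarrow> 0) at_top"
proof (induction N)
  case 0
  show ?case
  proof (intro exI[of _ "\<lambda>s. - exp (- (s * w)) / w"] conjI allI)
    show "((\<lambda>s. - exp (- (s * w)) / w) has_field_derivative s ^ 0 * exp (- (s * w))) (at s)" for s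
      using w by (auto intro!: derivative_eq_intros)
    show "((\<lambda>s. - exp (- (of_real s * w)) / w) \<longlongrightarrow> 0) at_top"
      using tendsto_divide[OF tendsto_minus[OF lim[of 0]] tendsto_const w] by simp
  qed simp
next
  case (Suc N)
  then obtain F where F: "\<And>s. (F has_field_derivative s ^ N * exp (- (s * w))) (at s)"
     "F 0 = - (fact N / w ^ (N + 1))" "((\<lambda>s. F (of_real s)) \<longlongrightarrow> 0) at_top" by blast
  let ?F = "\<lambda>s. (of_nat (Suc N) * F s - s ^ Suc N * exp (- (s * w))) / w"
  show ?case
  proof (intro exI[of _ ?F] conjI allI)
    show "(?F has_field_derivative s ^ Suc N * exp (- (s * w))) (at s)" for s
      by (rule derivative_eq_intros F refl | use w in \<open>simp add: field_simps\<close>)+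
    show "?F 0 = - (fact (Suc N) / w ^ (Suc N + 1))"
      using w by (simp add: F(2) field_simps)
    have "((\<lambda>s. ?F (of_real s)) \<longlongrightarrow> (of_nat (Suc N) * 0 - 0) / w) at_top"
      by (intro tendsto_divide tendsto_diff tendsto_mult tendsto_const F(3) lim w)
    then show "((\<lambda>s. ?F (of_real s)) \<longlongrightarrow> 0) at_top" by simp
  qed
qed

lemma einterval_0_infinity: "einterval 0 \<infinity> = {0<..}"
  by (auto simp: einterval_def)

lemma FTC_limits:
  fixes F :: "real \<Rightarrow> 'a::real_normed_vector"
  assumes "isCont F 0" "(F \<longlongrightarrow> l) at_top"
  shows "((F \<circ> real_of_ereal) \<longlongrightarrow> F 0) (at_right 0)" "((F \<circ> real_of_ereal) \<longlongrightarrow> l) (at_left \<infinity>)"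
proof -
  have "(F \<longlongrightarrow> F 0) (at_right 0)"
    using assms(1) by (simp add: isCont_def filterlim_at_split)
  then show "((F \<circ> real_of_ereal) \<longlongrightarrow> F 0) (at_right 0)"
    by (simp add: ereal_tendsto_simps1 zero_ereal_def)
  show "((F \<circ> real_of_ereal) \<longlongrightarrow> l) (at_left \<infinity>)"
    using assms(2) by (simp add: ereal_tendsto_simps1)
qed

lemma set_integrable_power_mult_exp_neg:
  assumes x: "x > (0::real)"
  shows "set_integrable lborel {0<..} (\<lambda>s. s ^ N * exp (- (s * x)))"
    and "(LINT s:{0<..}|lborel. s ^ N * exp (- (s * x))) = fact N / x ^ (N + 1)"
proof -
  obtain F where F: "\<And>s. (F has_field_derivative s ^ N * exp (- (s * x))) (at s)"
     "F 0 = - (fact N / x ^ (N + 1))" "(F \<longlongrightarrow> 0) at_top"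
    using ex_antiderivative_power_mult_exp[of x N] tendsto_power_mult_exp_neg[OF x] x by auto
  note lims = FTC_limits[OF DERIV_isCont[OF F(1)] F(3)]
  have der: "\<And>s. 0 < ereal s \<Longrightarrow> ereal s < \<infinity> \<Longrightarrow> DERIV F s :> s ^ N * exp (- (s * x))"
    by (rule F(1))
  have cont: "\<And>s. 0 < ereal s \<Longrightarrow> ereal s < \<infinity> \<Longrightarrow> isCont (\<lambda>s. s ^ N * exp (- (s * x))) s"
    by (intro continuous_intros)
  have nn: "AE s in lborel. 0 < ereal s \<longrightarrow> ereal s < \<infinity> \<longrightarrow> 0 \<le> s ^ N * exp (- (s * x))"
    by auto
  note FTC = interval_integral_FTC_nonneg[OF _ der cont nn lims]
  show "set_integrable lborel {0<..} (\<lambda>s. s ^ N * exp (- (s * x)))"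
    using FTC(1) by (simp add: einterval_0_infinity)
  show "(LINT s:{0<..}|lborel. s ^ N * exp (- (s * x))) = fact N / x ^ (N + 1)"
    using FTC(2) F(2) by (simp add: interval_lebesgue_integral_def einterval_0_infinity)
qed

lemma set_integral_power_mult_exp_neg_complex:
  assumes w: "Re w > 0"
  shows "set_integrable lborel {0<..} (\<lambda>s. of_real s ^ N * exp (- (of_real s * w)))"
    and "(LINT s:{0<..}|lborel. of_real s ^ N * exp (- (of_real s * w))) = fact N / w ^ (N + 1)"
proof -
  have norm_eq: "norm (of_real s ^ k * exp (- (of_real s * w))) = \<bar>s\<bar> ^ k * exp (- (s * Re w))"
      for s :: real and k
    by (simp add: norm_mult norm_power norm_exp_eq_Re)
  have lim: "((\<lambda>s. complex_of_real s ^ k * exp (- (of_real s * w))) \<longlongrightarrow> 0) at_top" for k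
  proof (rule tendsto_norm_zero_cancel, rule Lim_transform_eventually)
    show "((\<lambda>s. s ^ k * exp (- (s * Re w))) \<longlongrightarrow> 0) at_top"
      by (rule tendsto_power_mult_exp_neg[OF w])
    show "\<forall>\<^sub>F s in at_top. s ^ k * exp (- (s * Re w))
        = norm (complex_of_real s ^ k * exp (- (of_real s * w)))"
      using eventually_ge_at_top[of 0] by eventually_elim (simp only: norm_eq abs_of_nonneg)
  qed
  show int: "set_integrable lborel {0<..} (\<lambda>s. complex_of_real s ^ N * exp (- (of_real s * w)))"
  proof (rule set_integrable_bound[OF set_integrable_power_mult_exp_neg(1)[OF w, of N]])
    show "set_borel_measurable lborel {0<..} (\<lambda>s. complex_of_real s ^ N * exp (- (of_real s * w)))"
      unfolding set_borel_measurable_def by measurable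
    show "AE s in lborel. s \<in> {0<..} \<longrightarrow>
        norm (complex_of_real s ^ N * exp (- (of_real s * w))) \<le> norm (s ^ N * exp (- (s * Re w)))"
      by (simp add: norm_eq abs_mult power_abs)
  qed
  have w0: "w \<noteq> 0" using w by auto
  obtain F where F: "\<And>s. (F has_field_derivative s ^ N * exp (- (s * w))) (at s)"
     "F 0 = - (fact N / w ^ (N + 1))" "((\<lambda>s. F (of_real s)) \<longlongrightarrow> 0) at_top"
    using ex_antiderivative_power_mult_exp[OF w0 lim, of N] by auto
  have dF: "((\<lambda>s. F (of_real s)) has_vector_derivative of_real s ^ N * exp (- (of_real s * w)))
      (at s)" for s :: real
    by (rule has_vector_derivative_real_field[OF F(1)])
  have "isCont (\<lambda>s. F (complex_of_real s)) 0"
    using has_vector_derivative_continuous[OF dF[of 0]] .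
  note lims = FTC_limits[OF this F(3)]
  have "(LBINT s=0..\<infinity>. of_real s ^ N * exp (- (of_real s * w))) = 0 - F (of_real 0)"
  proof (rule interval_integral_FTC_integrable[OF _ dF _ _ lims])
    show "isCont (\<lambda>s. complex_of_real s ^ N * exp (- (of_real s * w))) s" for s
      by (intro continuous_intros)
  qed (use int in \<open>auto simp: einterval_0_infinity\<close>)
  then show "(LINT s:{0<..}|lborel. of_real s ^ N * exp (- (of_real s * w))) = fact N / w ^ (N + 1)"
    using F(2) by (simp add: interval_lebesgue_integral_def einterval_0_infinity)
qed

lemma powr_minus_of_nat:
  "w \<noteq> 0 \<Longrightarrow> w powr (- of_nat k) = 1 / w ^ k" for w :: complex
  by (simp add: powr_minus powr_nat' inverse_eq_divide)

lemma summable_num_compositions_exp: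
  assumes s: "s > (0::real)"
  shows "summable (\<lambda>m. real (num_compositions N m) * exp (- (real m * s)))"
proof (rule summable_comparison_test_ev)
  show "summable (\<lambda>m. norm (of_nat (num_compositions N m) * (1 + of_nat m) powr (- of_nat (N + 1))
      :: complex))"
    by (rule summable_norm_zeta_sum) simp
  have "((\<lambda>m. (real (Suc m)) ^ (N + 1) * exp (- (real (Suc m) * s))) \<longlongrightarrow> 0) sequentially"
    using filterlim_compose[OF tendsto_power_mult_exp_neg[OF s, of "N + 1"]
        filterlim_compose[OF filterlim_real_sequentially filterlim_Suc]] .
  from order_tendstoD(2)[OF this, of "exp (- s)"]
  have "\<forall>\<^sub>F m in sequentially. (real (Suc m)) ^ (N + 1) * exp (- (real (Suc m) * s)) < exp (- s)"
    by simp
  then show "\<forall>\<^sub>F m in sequentially. norm (real (num_compositions N m) * exp (- (real m * s)))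
     \<le> norm (of_nat (num_compositions N m) * (1 + of_nat m) powr (- of_nat (N + 1)) :: complex)"
  proof eventually_elim
    case (elim m)
    have "exp (- (real (Suc m) * s)) = exp (- s) * exp (- (real m * s))"
      by (simp add: algebra_simps flip: exp_add)
    then have "exp (- s) * (real (Suc m) ^ (N + 1) * exp (- (real m * s))) < exp (- s) * 1"
      using elim by (simp only: mult.left_commute mult_1_right)
    then have "(real (Suc m)) ^ (N + 1) * exp (- (real m * s)) \<le> 1"
      by (simp only: mult_less_cancel_left_pos exp_gt_zero)
    moreover have "real (Suc m) ^ (N + 1) > 0" by simp
    ultimately have "exp (- (real m * s)) \<le> 1 / (real (Suc m)) ^ (N + 1)"
      by (simp only: pos_le_divide_eq mult.commute)
    also have "\<dots> = norm ((1 + of_nat m :: complex) powr (- of_nat (N + 1)))"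
    proof -
      have eq: "(1 + of_nat m :: complex) = of_nat (Suc m)" by simp
      have "of_nat (Suc m) \<noteq> (0 :: complex)" by (rule of_nat_neq_0)
      then show ?thesis
        unfolding eq by (subst powr_minus_of_nat) (simp_all only: norm_divide norm_power norm_of_nat
            norm_one not_False_eq_True)
    qed
    finally show ?case
      by (simp add: norm_mult mult_left_mono del: of_nat_Suc)
  qed
qed

section \<open>Zeta differences at shifts with equal sums\<close>

lemma rho_eq_max:
  "rho n a b t = (\<Sum>k=1..n. max 0 (t - a k)) - (\<Sum>k=1..n. max 0 (t - b k))"
  unfolding rho_def by (intro arg_cong2[where f = minus] sum.cong) (auto simp: indicator_def)

lemma continuous_on_rho: "continuous_on A (rho n a b)"
  unfolding rho_eq_max[abs_def] by (intro continuous_intros)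

text \<open>
  Two integrations by parts against \<open>max 0 (u - c)\<close>, whose second derivative is a unit mass at \<open>c\<close>.
\<close>
lemma has_integral_max_mult_deriv2:
  fixes G G' G'' :: "real \<Rightarrow> complex"
  assumes A: "0 \<le> c" "c \<le> A"
    and G: "\<And>u. u \<in> {0..A} \<Longrightarrow> (G has_vector_derivative G' u) (at u within {0..A})"
    and G': "\<And>u. u \<in> {0..A} \<Longrightarrow> (G' has_vector_derivative G'' u) (at u within {0..A})"
  shows "((\<lambda>u. of_real (max 0 (u - c)) * G'' u) has_integral
           (of_real (A - c) * G' A - G A + G c)) {0..A}"
proof -
  have 1: "((\<lambda>u. of_real (max 0 (u - c)) * G'' u) has_integral 0) {0..c}"
    by (rule has_integral_is_0) auto
  have "((\<lambda>u. of_real (u - c) * G'' u) has_integral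
      ((of_real (A - c) * G' A - G A) - (of_real (c - c) * G' c - G c))) {c..A}"
  proof (rule fundamental_theorem_of_calculus)
    fix u assume u: "u \<in> {c..A}"
    have "((\<lambda>u. of_real (u - c) * G' u - G u) has_vector_derivative
         (of_real (u - c) * G'' u + of_real 1 * G' u) - G' u) (at u within {0..A})"
      by (intro has_vector_derivative_diff has_vector_derivative_mult has_vector_derivative_of_real
          G G')
         (use u A in \<open>auto intro!: derivative_eq_intros\<close>)
    then have "((\<lambda>u. of_real (u - c) * G' u - G u) has_vector_derivative
         (of_real (u - c) * G'' u + of_real 1 * G' u) - G' u) (at u within {c..A})"
      by (rule has_vector_derivative_within_subset) (use A in auto)
    then show "((\<lambda>u. of_real (u - c) * G' u - G u) has_vector_derivative
        of_real (u - c) * G'' u) (at u within {c..A})" by simp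
  qed (use A in auto)
  then have "((\<lambda>u. of_real (max 0 (u - c)) * G'' u) has_integral
      ((of_real (A - c) * G' A - G A) - (of_real (c - c) * G' c - G c))) {c..A}"
    by (rule has_integral_eq[rotated]) auto
  from has_integral_combine[OF A 1 this] show ?thesis by (simp add: algebra_simps)
qed

lemma higher_deriv_sum:
  fixes f :: "'i \<Rightarrow> complex \<Rightarrow> complex"
  assumes "\<And>i. i \<in> I \<Longrightarrow> f i holomorphic_on S" "open S" "z \<in> S"
  shows "(deriv ^^ j) (\<lambda>w. \<Sum>i\<in>I. f i w) z = (\<Sum>i\<in>I. (deriv ^^ j) (f i) z)"
  using assms(1)
proof (induction I rule: infinite_finite_induct)
  case (insert i I)
  have "(deriv ^^ j) (\<lambda>w. f i w + (\<Sum>i\<in>I. f i w)) z =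
      (deriv ^^ j) (f i) z + (deriv ^^ j) (\<lambda>w. \<Sum>i\<in>I. f i w) z"
    by (rule higher_deriv_add[OF _ _ assms(2,3)]) (use insert in \<open>auto intro!: holomorphic_intros\<close>)
  then show ?case using insert by simp
qed auto

text \<open>
  The hypotheses on the shifts under which \<^const>\<open>rho\<close> has compact support.
\<close>
locale balanced_shifts =
  fixes n :: nat and a b :: "nat \<Rightarrow> real"
  assumes a_nonneg: "k \<in> {1..n} \<Longrightarrow> 0 \<le> a k" and b_nonneg: "k \<in> {1..n} \<Longrightarrow> 0 \<le> b k"
    and sum_eq: "(\<Sum>k=1..n. a k) = (\<Sum>k=1..n. b k)"
begin

text \<open>
  A convenient right end point of an interval \<open>{0..T}\<close> that contains all shifts, and thereby the support
  of \<^const>\<open>rho\<close>.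
\<close>
definition T where "T = (\<Sum>k=1..n. a k)"

lemma a_le_T: "k \<in> {1..n} \<Longrightarrow> a k \<le> T"
  unfolding T_def by (rule member_le_sum) (use a_nonneg in auto)

lemma b_le_T: "k \<in> {1..n} \<Longrightarrow> b k \<le> T"
  unfolding T_def sum_eq by (rule member_le_sum) (use b_nonneg in auto)

lemma T_nonneg: "0 \<le> T"
  unfolding T_def by (rule sum_nonneg) (use a_nonneg in auto)

text \<open>
  To the right of all shifts, \<^const>\<open>rho\<close> equals \<open>\<Sum>\<^sub>k (t - a\<^sub>k) - \<Sum>\<^sub>k (t - b\<^sub>k)\<close>, which vanishes because the
  sums of the shifts agree.
\<close>
lemma rho_eq_0:
  assumes "t \<notin> {0<..<T}"
  shows "rho n a b t = 0"
proof (cases "t \<le> 0")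
  case True
  have "(\<Sum>k=1..n. max 0 (t - c k)) = 0" if "\<And>k. k \<in> {1..n} \<Longrightarrow> 0 \<le> c k" for c
    by (rule sum.neutral) (use True that in fastforce)
  from this[OF a_nonneg] this[OF b_nonneg] show ?thesis by (simp add: rho_eq_max)
next
  case False
  then have t: "t \<ge> T" using assms by auto
  have "(\<Sum>k=1..n. max 0 (t - a k)) = (\<Sum>k=1..n. t - a k)"
    by (rule sum.cong) (use a_le_T t in fastforce)+
  moreover have "(\<Sum>k=1..n. max 0 (t - b k)) = (\<Sum>k=1..n. t - b k)"
    by (rule sum.cong) (use b_le_T t in fastforce)+
  ultimately show ?thesis
    unfolding rho_eq_max using sum_eq by (simp add: sum_subtractf)
qed

text \<open>
  The boundary terms at \<open>T\<close> cancel: those with \<open>G T\<close> because there are as many \<open>a\<^sub>k\<close> as \<open>b\<^sub>k\<close>, those with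
  \<open>G' T\<close> because the sums of the shifts agree.
\<close>
lemma integral_rho_deriv2:
  fixes G G' G'' :: "real \<Rightarrow> complex"
  assumes G: "\<And>u. u \<in> {0..T} \<Longrightarrow> (G has_vector_derivative G' u) (at u within {0..T})"
    and G': "\<And>u. u \<in> {0..T} \<Longrightarrow> (G' has_vector_derivative G'' u) (at u within {0..T})"
  shows "integral {0..T} (\<lambda>u. of_real (rho n a b u) * G'' u) = (\<Sum>k=1..n. G (a k) - G (b k))"
proof -
  have "((\<lambda>u. (\<Sum>k=1..n. of_real (max 0 (u - a k)) * G'' u) - (\<Sum>k=1..n. of_real (max 0 (u - b k))
      * G'' u)) has_integral
     ((\<Sum>k=1..n. of_real (T - a k) * G' T - G T + G (a k)) - (\<Sum>k=1..n. of_real (T - b k) * G' T - G T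
         + G (b k)))) {0..T}"
    by (intro has_integral_diff has_integral_sum has_integral_max_mult_deriv2 G G')
       (use a_nonneg b_nonneg a_le_T b_le_T in auto)
  also have "(\<lambda>u. (\<Sum>k=1..n. of_real (max 0 (u - a k)) * G'' u) - (\<Sum>k=1..n. of_real (max 0 (u - b k))
      * G'' u))
       = (\<lambda>u. of_real (rho n a b u) * G'' u)"
    unfolding rho_eq_max by (simp only: of_real_diff of_real_sum sum_distrib_right left_diff_distrib)
  also have "(\<Sum>k=1..n. of_real (T - a k) * G' T - G T + G (a k)) - (\<Sum>k=1..n. of_real (T - b k)
      * G' T - G T + G (b k))
     = of_real ((\<Sum>k=1..n. b k) - (\<Sum>k=1..n. a k)) * G' T + (\<Sum>k=1..n. G (a k) - G (b k))"
    by (simp only: of_real_diff of_real_sum sum_distrib_right left_diff_distrib sum.distrib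
        sum_subtractf)
       (simp add: algebra_simps)
  finally have "((\<lambda>u. of_real (rho n a b u) * G'' u) has_integral
     (of_real ((\<Sum>k=1..n. b k) - (\<Sum>k=1..n. a k)) * G' T + (\<Sum>k=1..n. G (a k) - G (b k)))) {0..T}" .
  from this[unfolded sum_eq] show ?thesis by (simp add: integral_unique)
qed

text \<open>
  The analytic part of \<open>\<partial>\<^sub>z\<^bsup>N-1\<^esup> D(s, z)\<close>, up to sign and the factor \<open>s (s + 1) \<dots> (s + N)\<close>. The
  exponent \<open>s + N + 1\<close> keeps it inside the domain of convergence for all \<open>Re s > -1\<close>.
\<close>
definition rho_zeta :: "nat \<Rightarrow> complex \<Rightarrow> complex \<Rightarrow> complex" where
  "rho_zeta N s z = integral {0..T} (\<lambda>u. of_real (rho n a b u) * zeta_sum N (s + of_nat (N + 1)) (z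
      + of_real u))"

lemma holomorphic_on_rho_zeta:
  assumes z: "z \<in> slit_plane"
  shows "(\<lambda>s. rho_zeta N s z) holomorphic_on {s. Re s > -1}"
proof -
  have "jointly_holomorphic_on (\<lambda>s z. integral {0..T} (\<lambda>u. of_real (rho n a b u) *
          zeta_sum N (s + of_nat (N + 1)) (z + of_real u))) {s. Re s > -1} slit_plane"
  proof (rule jointly_holomorphic_on_integral)
    show "jointly_holomorphic_on (\<lambda>s. zeta_sum N (s + of_nat (N + 1))) {s. Re s > -1} slit_plane"
      by (rule jointly_holomorphic_on_compose[OF jointly_holomorphic_on_zeta_sum[of N],
            of "\<lambda>s. s + of_nat (N + 1)" _ "\<lambda>z. z"])
         (auto intro!: holomorphic_intros)
    show "continuous_on {0..T} (\<lambda>u. complex_of_real (rho n a b u))"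
      by (intro continuous_intros continuous_on_rho)
    show "z + of_real u \<in> slit_plane" if "z \<in> slit_plane" "u \<in> {0..T}" for z u
      using that by (intro slit_plane_add_real) auto
  qed (rule open_halfplane_Re_gt open_slit_plane)+
  from jointly_holomorphic_onD(2)[OF this z] show ?thesis by (simp add: rho_zeta_def)
qed

text \<open>
  The case \<open>G(u) = Z\<^sub>N(s, z + u)\<close> of \<open>integral_rho_deriv2\<close>. Both sides converge for \<open>Re s > N\<close>, but the
  right-hand side does so for \<open>Re s > N - 2\<close>. Together with the gain of \<open>N - 1\<close> from the derivatives in \<open>z\<close>
  this makes the point \<open>s = 0\<close> accessible.
\<close>
lemma sum_diff_zeta_sum:
  assumes s: "Re s > real N" and z: "z \<in> slit_plane"
  shows "(\<Sum>k=1..n. zeta_sum N s (z + of_real (a k)) - zeta_sum N s (z + of_real (b k))) =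
     s * (s + 1) * integral {0..T} (\<lambda>u. of_real (rho n a b u) * zeta_sum N (s + 2) (z + of_real u))"
proof -
  have der: "((\<lambda>u. c * zeta_sum N s' (z + of_real u)) has_vector_derivative
         c * (- s' * zeta_sum N (s' + 1) (z + of_real u))) (at u within {0..T})"
    if s': "Re s' > real N" and u: "u \<in> {0..T}" for s' u c
  proof -
    have zu: "z + of_real u \<in> slit_plane" using u z by (intro slit_plane_add_real) auto
    have "((\<lambda>u. z + u) has_field_derivative 1) (at (of_real u))"
      by (auto intro!: derivative_eq_intros)
    from DERIV_chain2[where f = "zeta_sum N s'" and g = "\<lambda>u. z + u", OF
        has_field_derivative_zeta_sum[OF s' zu] this]
    have "((\<lambda>u. c * zeta_sum N s' (z + u)) has_field_derivative c
        * (- s' * zeta_sum N (s' + 1) (z + of_real u))) (at (of_real u))"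
      by (intro DERIV_cmult) simp
    from has_vector_derivative_real_field[OF this] show ?thesis
      by (rule has_vector_derivative_at_within)
  qed
  have "integral {0..T} (\<lambda>u. of_real (rho n a b u)
      * (- s * (- (s + 1) * zeta_sum N (s + 1 + 1) (z + of_real u))))
     = (\<Sum>k=1..n. zeta_sum N s (z + of_real (a k)) - zeta_sum N s (z + of_real (b k)))"
  proof (rule integral_rho_deriv2)
    show "((\<lambda>u. zeta_sum N s (z + of_real u)) has_vector_derivative - s * zeta_sum N (s + 1) (z
        + of_real u)) (at u within {0..T})"
      if "u \<in> {0..T}" for u using der[OF s that, of 1] by simp
    show "((\<lambda>u. - s * zeta_sum N (s + 1) (z + of_real u)) has_vector_derivative
        - s * (- (s + 1) * zeta_sum N (s + 1 + 1) (z + of_real u))) (at u within {0..T})"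
      if "u \<in> {0..T}" for u by (rule der) (use s that in auto)
  qed
  moreover have "integral {0..T} (\<lambda>u. of_real (rho n a b u)
      * (- s * (- (s + 1) * zeta_sum N (s + 1 + 1) (z + of_real u))))
     = integral {0..T} (\<lambda>u. s * (s + 1) * (of_real (rho n a b u) * zeta_sum N (s + 2) (z + of_real u)))"
    by (rule integral_cong) (simp add: algebra_simps)
  ultimately show ?thesis by simp
qed

definition zeta_ext_diff :: "nat \<Rightarrow> complex \<Rightarrow> complex \<Rightarrow> complex" where
  "zeta_ext_diff N s z = (\<Sum>k=1..n. zeta_ext N s (z + of_real (a k)) - zeta_ext N s (z + of_real (b k)))"

lemma jointly_holomorphic_on_zeta_ext_diff: "jointly_holomorphic_on (zeta_ext_diff N) UNIV slit_plane"
proof -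
  have "jointly_holomorphic_on (\<lambda>s z. zeta_ext N s (z + of_real c)) UNIV slit_plane" if "c \<ge> 0" for c
    by (rule jointly_holomorphic_on_compose[OF jointly_holomorphic_on_zeta_ext, of "\<lambda>s. s"])
       (use slit_plane_add_real that in \<open>auto intro!: holomorphic_intros simp: image_subset_iff\<close>)
  then show ?thesis
    unfolding zeta_ext_diff_def[abs_def] using a_nonneg b_nonneg
    by (intro jointly_holomorphic_on_sum jointly_holomorphic_on_diff) auto
qed

text \<open>
  The \<open>N - 1\<close> derivatives raise the exponent to \<open>s + N - 1\<close>, and \<open>sum_diff_zeta_sum\<close> raises it by \<open>2\<close>
  more; the factors produced combine to \<open>s (s + 1) \<dots> (s + N)\<close>.
\<close>
lemma higher_deriv_zeta_ext_diff_right: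
  assumes N: "N \<ge> 1" and s: "Re s > real N" and z: "z \<in> slit_plane"
  shows "(deriv ^^ (N - 1)) (zeta_ext_diff N s) z =
           pole_factor N s * ((-1) ^ (N - 1) * pochhammer s (N + 1) * rho_zeta N s z)"
proof -
  define W where "W c = (\<lambda>z. zeta_sum N s (z + of_real c))" for c
  have hol: "zeta_sum N s holomorphic_on slit_plane"
    by (rule jointly_holomorphic_onD(3)[OF jointly_holomorphic_on_zeta_sum]) (use s in auto)
  have W: "W c holomorphic_on slit_plane" if "c \<ge> 0" for c
  proof -
    have "(zeta_sum N s \<circ> (\<lambda>z. z + of_real c)) holomorphic_on slit_plane"
      by (rule holomorphic_on_compose_gen[OF _ hol])
         (use slit_plane_add_real that in \<open>auto intro!: holomorphic_intros simp: image_subset_iff\<close>)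
    then show ?thesis by (simp add: W_def o_def)
  qed
  have dW: "(deriv ^^ j) (W c) z = (-1) ^ j * pochhammer s j * zeta_sum N (s + of_nat j) (z
      + of_real c)"
    if "c \<ge> 0" for c j
  proof -
    have "(deriv ^^ j) (W c) z = (deriv ^^ j) (zeta_sum N s) (z + of_real c)"
      unfolding W_def
      using higher_deriv_compose_linear'[OF hol open_slit_plane open_slit_plane z, of 1 "of_real c" j]
        slit_plane_add_real that by (simp add: add.commute)
    then show ?thesis
      using higher_deriv_zeta_sum[OF s slit_plane_add_real[OF z that]] by simp
  qed
  have "(deriv ^^ (N - 1)) (zeta_ext_diff N s) z =
      (deriv ^^ (N - 1)) (\<lambda>z. pole_factor N s * (\<Sum>k=1..n. W (a k) z - W (b k) z)) z"
  proof (rule higher_deriv_cong_ev)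
    show "\<forall>\<^sub>F z in nhds z. zeta_ext_diff N s z = pole_factor N s * (\<Sum>k=1..n. W (a k) z - W (b k) z)"
      using eventually_nhds_in_open[OF open_slit_plane z]
    proof eventually_elim
      case (elim w)
      have "zeta_ext N s (w + of_real c) = pole_factor N s * W c w" if "c \<ge> 0" for c
        unfolding W_def by (rule zeta_ext_eq[OF s slit_plane_add_real[OF elim that]])
      then show ?case
        unfolding zeta_ext_diff_def using a_nonneg b_nonneg
        by (simp add: sum_distrib_left right_diff_distrib)
    qed
  qed auto
  also have "\<dots> = pole_factor N s * (deriv ^^ (N - 1)) (\<lambda>z. \<Sum>k=1..n. W (a k) z - W (b k) z) z"
    by (rule higher_deriv_cmult[OF _ z open_slit_plane])
       (use W a_nonneg b_nonneg in \<open>auto intro!: holomorphic_intros\<close>)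
  also have "(deriv ^^ (N - 1)) (\<lambda>z. \<Sum>k=1..n. W (a k) z - W (b k) z) z =
      (\<Sum>k=1..n. (deriv ^^ (N - 1)) (\<lambda>z. W (a k) z - W (b k) z) z)"
    by (rule higher_deriv_sum[OF _ open_slit_plane z])
       (use W a_nonneg b_nonneg in \<open>auto intro!: holomorphic_intros\<close>)
  also have "\<dots> = (\<Sum>k=1..n. (deriv ^^ (N - 1)) (W (a k)) z - (deriv ^^ (N - 1)) (W (b k)) z)"
    by (intro sum.cong refl higher_deriv_diff[OF _ _ open_slit_plane z] W a_nonneg b_nonneg)
  also have "\<dots> = (\<Sum>k=1..n. (-1) ^ (N - 1) * pochhammer s (N - 1) *
      (zeta_sum N (s + of_nat (N - 1)) (z + of_real (a k)) - zeta_sum N (s + of_nat (N - 1)) (z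
          + of_real (b k))))"
    by (intro sum.cong refl) (simp add: dW a_nonneg b_nonneg right_diff_distrib)
  also have "\<dots> = (-1) ^ (N - 1) * pochhammer s (N - 1) *
      ((s + of_nat (N - 1)) * (s + of_nat (N - 1) + 1) * integral {0..T}
         (\<lambda>u. of_real (rho n a b u) * zeta_sum N (s + of_nat (N - 1) + 2) (z + of_real u)))"
    unfolding sum_distrib_left[symmetric]
    by (subst sum_diff_zeta_sum[OF _ z]) (use s in auto)
  also have "integral {0..T}
         (\<lambda>u. of_real (rho n a b u) * zeta_sum N (s + of_nat (N - 1) + 2) (z + of_real u))
             = rho_zeta N s z"
  proof -
    have "s + of_nat (N - 1) + 2 = s + of_nat (N + 1)" using N by (simp add: of_nat_diff)
    then show ?thesis by (simp only: rho_zeta_def)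
  qed
  also have "(-1) ^ (N - 1) * pochhammer s (N - 1) * ((s + of_nat (N - 1)) * (s + of_nat (N - 1)
      + 1) * rho_zeta N s z)
      = (-1) ^ (N - 1) * pochhammer s (N + 1) * rho_zeta N s z"
  proof -
    obtain M where "N = Suc M" using N by (cases N) auto
    then show ?thesis by (simp add: pochhammer_Suc algebra_simps)
  qed
  finally show ?thesis .
qed

text \<open>
  Both sides are holomorphic in \<open>s\<close>, so the identity theorem moves the previous lemma to a
  half-plane that contains \<open>0\<close>.
\<close>
lemma higher_deriv_zeta_ext_diff:
  assumes N: "N \<ge> 1" and s: "Re s > -1" and z: "z \<in> slit_plane"
  shows "(deriv ^^ (N - 1)) (zeta_ext_diff N s) z =
           pole_factor N s * ((-1) ^ (N - 1) * pochhammer s (N + 1) * rho_zeta N s z)"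
proof -
  let ?f = "\<lambda>s. (deriv ^^ (N - 1)) (zeta_ext_diff N s) z"
  let ?g = "\<lambda>s. pole_factor N s * ((-1) ^ (N - 1) * pochhammer s (N + 1) * rho_zeta N s z)"
  have "?f s = ?g s"
  proof (rule analytic_continuation_open[of "{s. Re s > real N}" "{s. Re s > -1}" ?f ?g])
    show "{s. Re s > real N} \<noteq> {}" by (auto intro!: exI[of _ "of_real (real N + 1)"])
    show "connected {s. Re s > -1}"
      by (intro convex_connected convex_halfspace_Re_gt)
    show "?g holomorphic_on {s. Re s > -1}"
      by (intro holomorphic_intros holomorphic_on_pole_factor holomorphic_on_rho_zeta z)
    show "?f holomorphic_on {s. Re s > -1}"
      by (rule holomorphic_onI, rule field_differentiable_at_within, unfold
          field_differentiable_def, rule exI,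
          rule has_field_derivative_higher_deriv_param[OF jointly_holomorphic_on_zeta_ext_diff])
         (use z open_slit_plane in auto)
    show "?f s = ?g s" if "s \<in> {s. Re s > real N}" for s
      by (rule higher_deriv_zeta_ext_diff_right) (use N z that in auto)
  qed (use s in \<open>auto intro: open_halfplane_Re_gt\<close>)
  then show ?thesis .
qed

text \<open>
  The logarithm of \<open>W\<close> is \<open>- \<partial>\<^sub>s D(0, z)\<close>. After \<open>\<partial>\<^sub>s\<close> and \<open>\<partial>\<^sub>z\<^bsup>N-1\<^esup>\<close> are exchanged,
  \<open>higher_deriv_zeta_ext_diff\<close> shows the function to be differentiated at \<open>s = 0\<close> as \<open>s\<close> times a holomorphic
  function \<open>H\<close>; its derivative is \<open>H(0)\<close>.
\<close>
lemma higher_deriv_log_W: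
  assumes N: "N \<ge> 1" and z: "Re z > 0"
  shows "(-1) ^ N * (deriv ^^ (N - 1)) (log_W (\<lambda>w. 1 / barnes_Gamma N w) n a b) z
      = fact N * rho_zeta N 0 z"
proof -
  have slit: "w \<in> slit_plane" if "Re w > 0" for w
    using that by (auto simp: complex_nonpos_Reals_iff)
  define U where "U s z = inverse (pole_factor N s) * zeta_ext_diff N s z" for s z
  have U: "jointly_holomorphic_on U (ball 0 1) slit_plane"
    unfolding U_def
    by (intro jointly_holomorphic_on_mult jointly_holomorphic_on_left holomorphic_intros
          holomorphic_on_pole_factor pole_factor_nonzero_near_0
          jointly_holomorphic_on_subset[OF jointly_holomorphic_on_zeta_ext_diff]) auto
  have logW: "log_W (\<lambda>w. 1 / barnes_Gamma N w) n a b w = - deriv (\<lambda>s. U s w) 0"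
      if w: "w \<in> slit_plane" for w
  proof -
    let ?q = "\<lambda>c s. zeta_ext N s (w + of_real c) / pole_factor N s"
    have q: "(?q c has_field_derivative log_barnes_Gamma N (w + of_real c)) (at 0)" if "c \<ge> 0" for c
      unfolding log_barnes_Gamma_def
      by (rule holomorphic_derivI[OF jointly_holomorphic_onD(2)[OF jointly_holomorphic_on_zeta_near_0]])
         (use slit_plane_add_real[OF w that] in auto)
    have "((\<lambda>s. \<Sum>k=1..n. ?q (a k) s - ?q (b k) s) has_field_derivative
        (\<Sum>k=1..n. log_barnes_Gamma N (w + of_real (a k)) - log_barnes_Gamma N (w + of_real (b k))))
            (at 0)"
      by (intro DERIV_sum DERIV_diff q a_nonneg b_nonneg)
    moreover have "(\<lambda>s. \<Sum>k=1..n. ?q (a k) s - ?q (b k) s) = (\<lambda>s. U s w)"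
      by (simp add: U_def zeta_ext_diff_def sum_distrib_left field_simps fun_eq_iff diff_divide_distrib)
    ultimately have "deriv (\<lambda>s. U s w) 0 =
        (\<Sum>k=1..n. log_barnes_Gamma N (w + of_real (a k)) - log_barnes_Gamma N (w + of_real (b k)))"
      using DERIV_imp_deriv by metis
    moreover have "log_W (\<lambda>w. 1 / barnes_Gamma N w) n a b w =
        (\<Sum>k=1..n. - log_barnes_Gamma N (w + of_real (a k)) - - log_barnes_Gamma N (w + of_real (b k)))"
      unfolding log_W_def
      by (intro sum.cong refl arg_cong2[where f = minus] log_branch_inverse_barnes_Gamma
            slit_plane_add_real w a_nonneg b_nonneg)
    ultimately show ?thesis by (simp add: sum_negf[symmetric])
  qed
  have "(deriv ^^ (N - 1)) (log_W (\<lambda>w. 1 / barnes_Gamma N w) n a b) z =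
      (deriv ^^ (N - 1)) (\<lambda>z. - deriv (\<lambda>s. U s z) 0) z"
    by (rule higher_deriv_cong_ev)
       (use logW eventually_nhds_in_open[OF open_slit_plane slit[OF z]] in \<open>auto elim: eventually_mono\<close>)
  also have "\<dots> = - (deriv ^^ (N - 1)) (\<lambda>z. deriv (\<lambda>s. U s z) 0) z"
    by (rule higher_deriv_uminus[OF holomorphic_on_deriv_param[OF U] open_slit_plane slit[OF z]])
       (use open_slit_plane in auto)
  finally have 1: "(deriv ^^ (N - 1)) (log_W (\<lambda>w. 1 / barnes_Gamma N w) n a b) z =
      - (deriv ^^ (N - 1)) (\<lambda>z. deriv (\<lambda>s. U s z) 0) z" .
  have d1: "((\<lambda>s. (deriv ^^ (N - 1)) (U s) z) has_field_derivative
      (deriv ^^ (N - 1)) (\<lambda>z. deriv (\<lambda>s. U s z) 0) z) (at 0)"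
    by (rule has_field_derivative_higher_deriv_param[OF U]) (use open_slit_plane slit[OF z] in auto)
  \<comment> \<open>The first factor of \<open>pochhammer s (N + 1)\<close> is split off.\<close>
  define H where "H s = (-1) ^ (N - 1) * pochhammer (s + 1) N * rho_zeta N s z" for s
  have dU: "(deriv ^^ (N - 1)) (U s) z = s * H s" if s: "s \<in> ball 0 1" for s
  proof -
    have "Re s > -1" using s abs_Re_le_cmod[of s] by auto
    have "(deriv ^^ (N - 1)) (U s) z = inverse (pole_factor N s)
        * (deriv ^^ (N - 1)) (zeta_ext_diff N s) z"
      unfolding U_def by (rule higher_deriv_cmult[OF _ slit[OF z] open_slit_plane])
        (rule jointly_holomorphic_onD(3)[OF jointly_holomorphic_on_zeta_ext_diff], simp)
    also have "\<dots> = (-1) ^ (N - 1) * pochhammer s (N + 1) * rho_zeta N s z"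
      using higher_deriv_zeta_ext_diff[OF N \<open>Re s > -1\<close> slit[OF z]] pole_factor_nonzero_near_0[OF s,
          of N] by simp
    also have "\<dots> = s * H s" by (simp add: H_def pochhammer_rec)
    finally show ?thesis .
  qed
  have "H holomorphic_on {s. Re s > -1}"
    unfolding H_def[abs_def] by (intro holomorphic_intros holomorphic_on_rho_zeta slit z)
  then have "(H has_field_derivative deriv H 0) (at 0)"
    by (rule holomorphic_derivI[OF _ open_halfplane_Re_gt]) auto
  then have "((\<lambda>s. s * H s) has_field_derivative H 0) (at 0)"
    by (auto intro!: derivative_eq_intros)
  then have "((\<lambda>s. (deriv ^^ (N - 1)) (U s) z) has_field_derivative H 0) (at 0)"
    by (rule has_field_derivative_transform_within_open[of _ _ _ "ball 0 1"]) (use dU in auto)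
  from DERIV_unique[OF d1 this] 1
  have "(deriv ^^ (N - 1)) (log_W (\<lambda>w. 1 / barnes_Gamma N w) n a b) z = - H 0" by simp
  moreover have "H 0 = (-1) ^ (N - 1) * fact N * rho_zeta N 0 z"
    by (simp add: H_def pochhammer_fact)
  ultimately show ?thesis using N by (cases N) (auto simp: mult.assoc simp flip: power_mult_distrib)
qed

section \<open>The integrals over \<open>\<phi>\<close> and over \<open>h g\<close>\<close>

lemma borel_measurable_rho [measurable]: "rho n a b \<in> borel_measurable borel"
  by (intro borel_measurable_continuous_onI continuous_on_rho)

definition rho_power :: "nat \<Rightarrow> complex \<Rightarrow> complex" where
  "rho_power N w = (LINT u:{0..T}|lborel. of_real (rho n a b u) / (w + of_real u) ^ (N + 1))"

lemma ex_rho_bound: obtains R where "R \<ge> 0" "\<And>u. \<bar>rho n a b u\<bar> \<le> R"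
proof -
  have "compact (rho n a b ` {0..T})"
    by (intro compact_continuous_image continuous_on_rho compact_Icc)
  then obtain R where R: "\<And>u. u \<in> {0..T} \<Longrightarrow> \<bar>rho n a b u\<bar> \<le> R"
    using compact_imp_bounded by (fastforce simp: bounded_iff)
  have "\<bar>rho n a b u\<bar> \<le> max R 0" for u
    using R[of u] rho_eq_0[of u] by (cases "u \<in> {0..T}") auto
  then show ?thesis using that[of "max R 0"] by auto
qed

lemma nonzero_add_of_real: "Re w > 0 \<Longrightarrow> u \<ge> 0 \<Longrightarrow> w + of_real u \<noteq> 0"
  by (auto simp: complex_eq_iff)

lemma continuous_on_rho_div:
  "Re w > 0 \<Longrightarrow> continuous_on {0..T} (\<lambda>u. complex_of_real (rho n a b u) / (w + of_real u) ^ (N + 1))"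
  using nonzero_add_of_real by (intro continuous_intros continuous_on_rho) auto

lemma set_integrable_rho_div:
  assumes "Re w > 0"
  shows "set_integrable lborel {0..T} (\<lambda>u. of_real (rho n a b u) / (w + of_real u) ^ (N + 1))"
  by (intro borel_integrable_atLeastAtMost' continuous_on_rho_div assms)

text \<open>
  For \<open>w = z + m\<close>, and weighted with \<^const>\<open>num_compositions\<close>, the bounds form a summable series in \<open>m\<close>.
  This justifies integrating the series over \<open>m\<close> term by term.
\<close>
lemma integral_norm_rho_div_le:
  assumes w: "Re w > 0" and R: "\<And>u. \<bar>rho n a b u\<bar> \<le> R"
  shows "(LINT u:{0..T}|lborel. norm (of_real (rho n a b u) / (w + of_real u) ^ (N + 1)))
           \<le> T * R * (1 / Re w ^ (N + 1))"
proof -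
  have "(LINT u:{0..T}|lborel. norm (of_real (rho n a b u) / (w + of_real u) ^ (N + 1)))
          \<le> (LINT u:{0..T}|lborel. R / Re w ^ (N + 1))"
  proof (rule set_integral_mono)
    show "set_integrable lborel {0..T} (\<lambda>u. norm (complex_of_real (rho n a b u) / (w + of_real u) ^
        (N + 1)))"
      by (rule set_integrable_norm[OF set_integrable_rho_div[OF w]])
    show "set_integrable lborel {0..T} (\<lambda>u. R / Re w ^ (N + 1))"
      by (intro borel_integrable_atLeastAtMost' continuous_intros)
    fix u assume u: "u \<in> {0..T}"
    have "Re w \<le> Re (w + of_real u)" using u by simp
    also have "\<dots> \<le> norm (w + of_real u)" by (rule complex_Re_le_cmod)
    finally have "Re w ^ (N + 1) \<le> norm (w + of_real u) ^ (N + 1)"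
      using w by (intro power_mono) auto
    then have "\<bar>rho n a b u\<bar> / norm (w + of_real u) ^ (N + 1) \<le> R / Re w ^ (N + 1)"
      using R[of u] w by (intro frac_le zero_less_power) (auto intro: order_trans[OF abs_ge_zero])
    then show "norm (complex_of_real (rho n a b u) / (w + of_real u) ^ (N + 1)) \<le> R / Re w ^ (N + 1)"
      by (simp only: norm_divide norm_power norm_of_real)
  qed
  also have "\<dots> = T * R * (1 / Re w ^ (N + 1))"
    using T_nonneg by (simp add: set_lebesgue_integral_def)
  finally show ?thesis .
qed

lemma summable_num_compositions_inverse_power:
  assumes "x > 0"
  shows "summable (\<lambda>m. real (num_compositions N m) * (1 / (x + real m) ^ (N + 1)))"
proof -
  have "norm (of_nat (num_compositions N m) * (of_real x + of_nat m :: complex) powr (- of_nat (N + 1)))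
     = real (num_compositions N m) * (1 / (x + real m) ^ (N + 1))" for m
  proof -
    have eq: "(of_real x + of_nat m :: complex) = of_real (x + real m)" by simp
    have pos: "x + real m > 0" using assms by (simp add: add_pos_nonneg)
    then have "complex_of_real (x + real m) \<noteq> 0" by (simp only: of_real_eq_0_iff)
    from powr_minus_of_nat[OF this] show ?thesis
      unfolding eq norm_mult using pos
      by (simp only: norm_divide norm_one norm_power norm_of_nat norm_of_real abs_of_pos)
  qed
  then show ?thesis
    using summable_norm_zeta_sum[of N "of_nat (N + 1)" "of_real x"] by (simp del: of_nat_Suc)
qed

lemma rho_zeta_eq_suminf:
  assumes z: "Re z > 0"
  shows "rho_zeta N 0 z = (\<Sum>m. of_nat (num_compositions N m) * rho_power N (z + of_nat m))"
proof -
  obtain R where R: "R \<ge> 0" "\<And>u. \<bar>rho n a b u\<bar> \<le> R" using ex_rho_bound by blast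
  have zm: "Re (z + of_nat m) > 0" for m using z by (simp add: add_pos_nonneg)
  define f where "f m u = indicator {0..T} u *\<^sub>R (of_nat (num_compositions N m) *
     (complex_of_real (rho n a b u) / (z + of_nat m + of_real u) ^ (N + 1)))" for m u
  have int: "integrable lborel (f m)" for m
    using set_integrable_mult_right[OF set_integrable_rho_div[OF zm], of "of_nat
        (num_compositions N m)" m N]
    by (simp add: f_def[abs_def] set_integrable_def)
  have term_eq: "of_real (rho n a b u) * (of_nat (num_compositions N m) * (z + of_real u + of_nat m)
      powr (- of_nat (N + 1)))
       = of_nat (num_compositions N m) * (complex_of_real (rho n a b u) / (z + of_nat m + of_real u)
           ^ (N + 1))"
    if "u \<ge> 0" for m u
  proof -
    have "z + of_nat m + of_real u \<noteq> 0" by (rule nonzero_add_of_real[OF zm that])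
    moreover have "z + of_real u + of_nat m = z + of_nat m + of_real u" by simp
    ultimately show ?thesis
      using powr_minus_of_nat[of "z + of_nat m + of_real u" "N + 1"]
      by (simp only: divide_inverse mult.left_commute mult_1_left simp_thms)
  qed
  have summ: "summable (\<lambda>m. norm (f m u))" for u
  proof (cases "u \<in> {0..T}")
    case True
    have "summable (\<lambda>m. norm (of_nat (num_compositions N m) * (z + of_real u + of_nat m) powr
        (- of_nat (N + 1))))"
      by (rule summable_norm_zeta_sum) simp
    then have "summable (\<lambda>m. norm (of_real (rho n a b u) *
       (of_nat (num_compositions N m) * (z + of_real u + of_nat m) powr (- of_nat (N + 1)))))"
      unfolding norm_mult[of "of_real (rho n a b u)"] by (rule summable_mult)
    then show ?thesis
      using True by (simp only: f_def term_eq indicator_simps scaleR_one atLeastAtMost_iff)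
  qed (simp add: f_def)
  have le: "(\<integral>u. norm (f m u) \<partial>lborel) \<le> T * R * (real (num_compositions N m)
      * (1 / (Re z + real m) ^ (N + 1)))" for m
  proof -
    have "(\<integral>u. norm (f m u) \<partial>lborel) = (LINT u:{0..T}|lborel. real (num_compositions N m) *
        norm (of_real (rho n a b u) / (z + of_nat m + of_real u) ^ (N + 1)))"
      unfolding set_lebesgue_integral_def
      by (intro Bochner_Integration.integral_cong refl) (simp add: f_def norm_mult norm_divide)
    also have "\<dots> = real (num_compositions N m) * (LINT u:{0..T}|lborel.
        norm (of_real (rho n a b u) / (z + of_nat m + of_real u) ^ (N + 1)))"
      by (rule set_integral_mult_right)
    also have "\<dots> \<le> real (num_compositions N m) * (T * R * (1 / Re (z + of_nat m) ^ (N + 1)))"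
      by (intro mult_left_mono integral_norm_rho_div_le zm R) auto
    finally show ?thesis by (simp add: mult_ac)
  qed
  have sums: "summable (\<lambda>m. \<integral>u. norm (f m u) \<partial>lborel)"
    by (rule summable_comparison_test'[OF summable_mult[OF
        summable_num_compositions_inverse_power[OF z], of "T * R" N]])
       (use le in \<open>simp add: integral_nonneg_AE\<close>)
  have "rho_zeta N 0 z = (LINT u:{0..T}|lborel. of_real (rho n a b u) * zeta_sum N (of_nat (N + 1))
      (z + of_real u))"
  proof -
    have "continuous_on {0..T} (\<lambda>u. zeta_sum N (of_nat (N + 1)) (z + of_real u))"
    proof (rule continuous_on_compose2[OF holomorphic_on_imp_continuous_on[OF
             jointly_holomorphic_onD(3)[OF jointly_holomorphic_on_zeta_sum]]])
      show "(\<lambda>u. z + complex_of_real u) ` {0..T} \<subseteq> slit_plane"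
        using z by (auto simp: complex_nonpos_Reals_iff)
    qed (auto intro!: continuous_intros)
    then have "set_integrable lborel {0..T} (\<lambda>u. of_real (rho n a b u) * zeta_sum N (of_nat (N + 1))
        (z + of_real u))"
      by (intro borel_integrable_atLeastAtMost' continuous_intros continuous_on_rho)
    from set_borel_integral_eq_integral(2)[OF this] show ?thesis
      by (simp only: rho_zeta_def add_0)
  qed
  also have "\<dots> = (\<integral>u. (\<Sum>m. f m u) \<partial>lborel)"
    unfolding set_lebesgue_integral_def
  proof (intro Bochner_Integration.integral_cong refl)
    fix u
    show "indicator {0..T} u *\<^sub>R (of_real (rho n a b u) * zeta_sum N (of_nat (N + 1)) (z
        + of_real u)) = (\<Sum>m. f m u)"
    proof (cases "u \<in> {0..T}")
      case True
      have "of_real (rho n a b u) * zeta_sum N (of_nat (N + 1)) (z + of_real u) =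
         (\<Sum>m. of_real (rho n a b u) * (of_nat (num_compositions N m) * (z + of_real u + of_nat m)
             powr (- of_nat (N + 1))))"
        unfolding zeta_sum_def by (rule suminf_mult[symmetric], rule summable_zeta_sum) simp
      then show ?thesis
        using True by (simp only: f_def term_eq indicator_simps scaleR_one atLeastAtMost_iff)
    qed (simp add: f_def)
  qed
  also have "\<dots> = (\<Sum>m. integral\<^sup>L lborel (f m))"
    by (rule integral_suminf[OF int _ sums]) (use summ in simp)
  also have "\<dots> = (\<Sum>m. of_nat (num_compositions N m) * rho_power N (z + of_nat m))"
  proof (intro suminf_cong)
    fix m
    show "integral\<^sup>L lborel (f m) = of_nat (num_compositions N m) * rho_power N (z + of_nat m)"
      unfolding rho_power_def set_integral_mult_right[symmetric]
          by (simp add: f_def[abs_def] set_lebesgue_integral_def)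
  qed
  finally show ?thesis .
qed

text \<open>
  The \<open>m\<close>-th term of \<open>\<phi>\<close> is a translate of \<^const>\<open>rho\<close> by \<open>m\<close>; undoing the translation turns \<open>z + t\<close> into
  \<open>z + m + u\<close>.
\<close>
lemma
  assumes N: "N \<ge> 1" and z: "Re z > 0"
  shows set_integrable_phi: "set_integrable lborel {0<..} (\<lambda>t. of_real (phi N n a b t) / (z
      + of_real t) ^ (N + 1))"
    and set_integral_phi: "(LINT t:{0<..}|lborel. of_real (phi N n a b t) / (z + of_real t) ^ (N
        + 1)) = rho_zeta N 0 z"
proof -
  obtain R where R: "R \<ge> 0" "\<And>u. \<bar>rho n a b u\<bar> \<le> R" using ex_rho_bound by blast
  have zm: "Re (z + of_nat m) > 0" for m using z by (simp add: add_pos_nonneg)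
  define f where "f m t = indicator {0<..} t *\<^sub>R (of_nat (num_compositions N m) *
     (complex_of_real (rho n a b (t - real m)) / (z + of_real t) ^ (N + 1)))" for m t
  have shift: "f m (real m + 1 * u) = indicator {0..T} u *\<^sub>R (of_nat (num_compositions N m) *
     (complex_of_real (rho n a b u) / (z + of_nat m + of_real u) ^ (N + 1)))" for m u
  proof (cases "u \<in> {0<..<T}")
    case True
    then have "real m + u > 0" by (intro add_nonneg_pos) auto
    then show ?thesis using True by (simp add: f_def add.assoc)
  qed (simp add: f_def rho_eq_0)
  have int: "integrable lborel (f m)" for m
  proof -
    have "integrable lborel (\<lambda>u. f m (real m + 1 * u))"
      using set_integrable_mult_right[OF set_integrable_rho_div[OF zm], of "of_nat
          (num_compositions N m)" m N]
      unfolding shift set_integrable_def by simp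
    then show ?thesis by (subst (asm) lborel_integrable_real_affine_iff) auto
  qed
  have le: "(\<integral>t. norm (f m t) \<partial>lborel) \<le> T * R * (real (num_compositions N m)
      * (1 / (Re z + real m) ^ (N + 1)))" for m
  proof -
    have "(\<integral>t. norm (f m t) \<partial>lborel) = (\<integral>u. norm (f m (real m + 1 * u)) \<partial>lborel)"
      using lborel_integral_real_affine[of 1 "\<lambda>t. norm (f m t)" "real m"] by simp
    also have "\<dots> = (LINT u:{0..T}|lborel. real (num_compositions N m) *
        norm (of_real (rho n a b u) / (z + of_nat m + of_real u) ^ (N + 1)))"
      unfolding set_lebesgue_integral_def shift
      by (intro Bochner_Integration.integral_cong refl) (simp add: norm_mult norm_divide)
    also have "\<dots> = real (num_compositions N m) * (LINT u:{0..T}|lborel.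
        norm (of_real (rho n a b u) / (z + of_nat m + of_real u) ^ (N + 1)))"
      by (rule set_integral_mult_right)
    also have "\<dots> \<le> real (num_compositions N m) * (T * R * (1 / Re (z + of_nat m) ^ (N + 1)))"
      by (intro mult_left_mono integral_norm_rho_div_le zm R) auto
    finally show ?thesis by (simp add: mult_ac)
  qed
  have sums: "summable (\<lambda>m. \<integral>t. norm (f m t) \<partial>lborel)"
    by (rule summable_comparison_test'[OF summable_mult[OF
        summable_num_compositions_inverse_power[OF z], of "T * R" N]])
       (use le in \<open>simp add: integral_nonneg_AE\<close>)
  have fin: "f m t = 0" if "m \<notin> {..nat \<lceil>t\<rceil>}" for m t
  proof -
    have "t - real m \<le> 0" using that by (simp add: not_le) linarith
    then show ?thesis by (simp add: f_def rho_eq_0)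
  qed
  have summ: "summable (\<lambda>m. norm (f m t))" for t
    by (rule summable_finite[of "{..nat \<lceil>t\<rceil>}"]) (use fin in auto)
  have phi_eq: "indicator {0<..} t *\<^sub>R (of_real (phi N n a b t) / (z + of_real t) ^ (N + 1))
      = (\<Sum>m. f m t)" for t
  proof -
    have zero: "real (num_compositions N m) * rho n a b (t - real m) = 0" if "m \<notin> {..nat \<lceil>t\<rceil>}" for m
    proof -
      have "t - real m \<le> 0" using that by (simp add: not_le) linarith
      then show ?thesis by (simp add: rho_eq_0)
    qed
    have "phi N n a b t = (\<Sum>m\<le>nat \<lceil>t\<rceil>. real (num_compositions N m) * rho n a b (t - real m))"
      unfolding phi_def num_compositions_eq_binomial[OF N, symmetric]
      by (rule suminf_finite) (use zero in auto)
    moreover have "(\<Sum>m. f m t) = (\<Sum>m\<le>nat \<lceil>t\<rceil>. f m t)"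
      by (rule suminf_finite) (use fin in auto)
    ultimately show ?thesis
      by (simp add: f_def scaleR_sum_right sum_divide_distrib)
  qed
  show "set_integrable lborel {0<..} (\<lambda>t. of_real (phi N n a b t) / (z + of_real t) ^ (N + 1))"
    unfolding set_integrable_def phi_eq by (rule integrable_suminf[OF int _ sums]) (use summ in simp)
  have "(LINT t:{0<..}|lborel. of_real (phi N n a b t) / (z + of_real t) ^ (N + 1))
      = (\<Sum>m. integral\<^sup>L lborel (f m))"
    unfolding set_lebesgue_integral_def phi_eq by (rule integral_suminf[OF int _ sums])
        (use summ in simp)
  also have "\<dots> = (\<Sum>m. of_nat (num_compositions N m) * rho_power N (z + of_nat m))"
  proof (intro suminf_cong)
    fix m
    have "integral\<^sup>L lborel (f m) = (\<integral>u. f m (real m + 1 * u) \<partial>lborel)"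
      using lborel_integral_real_affine[of 1 "f m" "real m"] by simp
    then show "integral\<^sup>L lborel (f m) = of_nat (num_compositions N m) * rho_power N (z + of_nat m)"
      unfolding rho_power_def set_integral_mult_right[symmetric] shift
          by (simp add: set_lebesgue_integral_def)
  qed
  also have "\<dots> = rho_zeta N 0 z" by (rule rho_zeta_eq_suminf[OF z, symmetric])
  finally show "(LINT t:{0<..}|lborel. of_real (phi N n a b t) / (z + of_real t) ^ (N + 1))
      = rho_zeta N 0 z" .
qed

text \<open>
  Apply \<open>integral_rho_deriv2\<close> to \<open>G(u) = e\<^bsup>-su\<^esup> / s\<^sup>2\<close>.
\<close>
lemma g_fun_eq_integral:
  assumes s: "s > 0"
  shows "complex_of_real (g_fun n a b s) = (LINT u:{0..T}|lborel. of_real (rho n a b u)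
      * of_real (exp (- (s * u))))"
proof -
  have "integral {0..T} (\<lambda>u. complex_of_real (rho n a b u) * of_real (exp (- (s * u)))) =
    (\<Sum>k=1..n. of_real (exp (- (s * a k)) / s\<^sup>2) - of_real (exp (- (s * b k)) / s\<^sup>2))"
  proof (rule integral_rho_deriv2)
    fix u :: real
    show "((\<lambda>u. complex_of_real (exp (- (s * u)) / s\<^sup>2)) has_vector_derivative of_real
        (- exp (- (s * u)) / s)) (at u within {0..T})"
      by (intro has_vector_derivative_of_real) (use s in \<open>auto intro!: derivative_eq_intros simp:
          power2_eq_square\<close>)
    show "((\<lambda>u. complex_of_real (- exp (- (s * u)) / s)) has_vector_derivative of_real
        (exp (- (s * u)))) (at u within {0..T})"
      by (intro has_vector_derivative_of_real) (use s in \<open>auto intro!: derivative_eq_intros\<close>)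
  qed
  moreover have "set_integrable lborel {0..T} (\<lambda>u. complex_of_real (rho n a b u)
      * of_real (exp (- (s * u))))"
    by (intro borel_integrable_atLeastAtMost' continuous_intros continuous_on_rho)
  from set_borel_integral_eq_integral(2)[OF this]
  have "(LINT u:{0..T}|lborel. of_real (rho n a b u) * of_real (exp (- (s * u)))) =
     integral {0..T} (\<lambda>u. complex_of_real (rho n a b u) * of_real (exp (- (s * u))))" .
  moreover have "complex_of_real (g_fun n a b s) =
     (\<Sum>k=1..n. of_real (exp (- (s * a k)) / s\<^sup>2) - of_real (exp (- (s * b k)) / s\<^sup>2))"
    unfolding g_fun_def by (simp add: sum_distrib_left diff_divide_distrib right_diff_distrib)
  ultimately show ?thesis by simp
qed

lemma abs_g_fun_le:
  assumes s: "s > 0" and R: "\<And>u. \<bar>rho n a b u\<bar> \<le> R"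
  shows "\<bar>g_fun n a b s\<bar> \<le> T * R"
proof -
  let ?f = "\<lambda>u. complex_of_real (rho n a b u) * of_real (exp (- (s * u)))"
  have int: "set_integrable lborel {0..T} ?f"
    by (intro borel_integrable_atLeastAtMost' continuous_intros continuous_on_rho)
  have "\<bar>g_fun n a b s\<bar> = norm (LINT u:{0..T}|lborel. ?f u)"
    using g_fun_eq_integral[OF s] by (metis norm_of_real)
  also have "\<dots> \<le> (LINT u:{0..T}|lborel. norm (?f u))"
    by (rule set_integral_norm_bound[OF int])
  also have "\<dots> \<le> (LINT u:{0..T}|lborel. R)"
  proof (rule set_integral_mono)
    show "set_integrable lborel {0..T} (\<lambda>u. norm (?f u))"
      by (rule set_integrable_norm[OF int])
    show "set_integrable lborel {0..T} (\<lambda>u. R)"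
      by (intro borel_integrable_atLeastAtMost' continuous_intros)
    fix u assume "u \<in> {0..T}"
    then have "exp (- (s * u)) \<le> 1" using s by simp
    then have "\<bar>rho n a b u\<bar> * exp (- (s * u)) \<le> R * 1"
      using R[of u] by (intro mult_mono) (auto intro: order_trans[OF abs_ge_zero])
    then show "norm (?f u) \<le> R" by (simp add: norm_mult)
  qed
  also have "\<dots> = T * R"
    using T_nonneg by (simp add: set_lebesgue_integral_def)
  finally show ?thesis .
qed

text \<open>
  Fubini's theorem for \<open>\<rho>(u) s\<^sup>N e\<^bsup>-s(w + u)\<^esup>\<close>: integrating over \<open>u\<close> gives \<open>g\<close>, integrating over \<open>s\<close>
  gives \<open>N! / (w + u)\<^bsup>N+1\<^esup>\<close>.
\<close>
lemma
  assumes w: "Re w > 0"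
  shows set_integrable_laplace_g:
      "set_integrable lborel {0<..} (\<lambda>s. of_real s ^ N * exp (- (of_real s * w))
          * of_real (g_fun n a b s))"
    and set_integral_laplace_g:
      "(LINT s:{0<..}|lborel. of_real s ^ N * exp (- (of_real s * w)) * of_real (g_fun n a b s))
          = fact N * rho_power N w"
proof -
  define f where "f u s = indicator {0..T} u *\<^sub>R (complex_of_real (rho n a b u) *
     (indicator {0<..} s *\<^sub>R (of_real s ^ N * exp (- (of_real s * (w + of_real u))))))" for u s :: real
  have wu: "Re (w + of_real u) > 0" if "u \<in> {0..T}" for u using w that by (simp add: add_pos_nonneg)
  have int1: "integrable lborel (f u)" for u
  proof (cases "u \<in> {0..T}")
    case True
    have "integrable lborel (\<lambda>s. indicator {0<..} s *\<^sub>R (of_real s ^ N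
        * exp (- (of_real s * (w + of_real u)))))"
      using set_integral_power_mult_exp_neg_complex(1)[OF wu[OF True], of N]
          by (simp add: set_integrable_def)
    then show ?thesis unfolding f_def[abs_def] by (intro integrable_scaleR_right integrable_mult_right)
  qed (simp add: f_def[abs_def])
  have norm_f: "(\<integral>s. norm (f u s) \<partial>lborel) =
      indicator {0..T} u *\<^sub>R (\<bar>rho n a b u\<bar> * (fact N / (Re w + u) ^ (N + 1)))" for u
  proof (cases "u \<in> {0..T}")
    case True
    have "(\<integral>s. norm (f u s) \<partial>lborel) =
       (\<integral>s. \<bar>rho n a b u\<bar> * (indicator {0<..} s *\<^sub>R (s ^ N * exp (- (s * Re (w + of_real u)))))
           \<partial>lborel)"
      using True
      by (intro Bochner_Integration.integral_cong refl)
         (auto simp: f_def norm_mult norm_power norm_exp_eq_Re indicator_def)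
    also have "\<dots> = \<bar>rho n a b u\<bar> * (fact N / Re (w + of_real u) ^ (N + 1))"
      using set_integrable_power_mult_exp_neg(2)[OF wu[OF True], of N]
      unfolding set_lebesgue_integral_def by (simp only: integral_mult_right_zero)
    finally show ?thesis using True by simp
  qed (simp add: f_def)
  have int: "integrable (lborel \<Otimes>\<^sub>M lborel) (case_prod f)"
  proof (rule lborel_pair.Fubini_integrable)
    show "case_prod f \<in> borel_measurable (lborel \<Otimes>\<^sub>M lborel)"
      unfolding f_def case_prod_unfold by measurable
    have "set_integrable lborel {0..T} (\<lambda>u. \<bar>rho n a b u\<bar> * (fact N / (Re w + u) ^ (N + 1)))"
      using w by (intro borel_integrable_atLeastAtMost' continuous_intros continuous_on_rho) auto
    then show "integrable lborel (\<lambda>u. \<integral>s. norm (case (u, s) of (u, s) \<Rightarrow> f u s) \<partial>lborel)"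
      by (simp only: case_prod_conv norm_f set_integrable_def)
    show "AE u in lborel. integrable lborel (\<lambda>s. case (u, s) of (u, s) \<Rightarrow> f u s)"
      using int1 by simp
  qed
  have inner: "(\<integral>u. f u s \<partial>lborel) = indicator {0<..} s *\<^sub>R
     (of_real s ^ N * exp (- (of_real s * w)) * of_real (g_fun n a b s))" for s
  proof (cases "s > 0")
    case True
    have "(\<integral>u. f u s \<partial>lborel) = (LINT u:{0..T}|lborel. of_real s ^ N * exp (- (of_real s * w)) *
        (of_real (rho n a b u) * of_real (exp (- (s * u)))))"
      unfolding set_lebesgue_integral_def
    proof (intro Bochner_Integration.integral_cong refl)
      fix u
      have "exp (- (of_real s * (w + of_real u))) = exp (- (of_real s * w))
          * complex_of_real (exp (- (s * u)))"
        by (simp add: exp_of_real[symmetric] algebra_simps flip: exp_add)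
      then show "f u s = indicator {0..T} u *\<^sub>R (of_real s ^ N * exp (- (of_real s * w)) *
        (of_real (rho n a b u) * of_real (exp (- (s * u)))))"
        using True by (simp add: f_def)
    qed
    also have "\<dots> = of_real s ^ N * exp (- (of_real s * w)) * of_real (g_fun n a b s)"
      unfolding g_fun_eq_integral[OF True] by (rule set_integral_mult_right)
    finally show ?thesis using True by simp
  qed (simp add: f_def)
  show "set_integrable lborel {0<..} (\<lambda>s. of_real s ^ N * exp (- (of_real s * w))
      * of_real (g_fun n a b s))"
    using lborel_pair.integrable_snd[OF int] by (simp only: inner set_integrable_def)
  have "(LINT s:{0<..}|lborel. of_real s ^ N * exp (- (of_real s * w)) * of_real (g_fun n a b s)) =
      (\<integral>s. (\<integral>u. f u s \<partial>lborel) \<partial>lborel)"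
    by (simp only: inner set_lebesgue_integral_def)
  also have "\<dots> = (\<integral>u. (\<integral>s. f u s \<partial>lborel) \<partial>lborel)"
    by (rule lborel_pair.Fubini_integral[OF int])
  also have "\<dots> = (LINT u:{0..T}|lborel. fact N * (of_real (rho n a b u) / (w + of_real u) ^ (N + 1)))"
    unfolding set_lebesgue_integral_def
  proof (intro Bochner_Integration.integral_cong refl)
    fix u
    show "(\<integral>s. f u s \<partial>lborel) = indicator {0..T} u *\<^sub>R (fact N
        * (of_real (rho n a b u) / (w + of_real u) ^ (N + 1)))"
    proof (cases "u \<in> {0..T}")
      case True
      have "(\<integral>s. f u s \<partial>lborel) = of_real (rho n a b u) * (fact N / (w + of_real u) ^ (N + 1))"
        using set_integral_power_mult_exp_neg_complex(2)[OF wu[OF True], of N] True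
        unfolding set_lebesgue_integral_def f_def
            by (simp only: integral_mult_right_zero indicator_simps scaleR_one)
      then show ?thesis using True by simp
    qed (simp add: f_def)
  qed
  also have "\<dots> = fact N * rho_power N w"
    unfolding rho_power_def by (rule set_integral_mult_right)
  finally show "(LINT s:{0<..}|lborel. of_real s ^ N * exp (- (of_real s * w))
      * of_real (g_fun n a b s)) = fact N * rho_power N w" .
qed

text \<open>
  The factor \<open>e\<^bsup>-ms\<^esup>\<close> of the \<open>m\<close>-th term of \<open>h\<close> replaces \<open>z\<close> by \<open>z + m\<close> in \<open>set_integral_laplace_g\<close>.
\<close>
lemma
  assumes N: "N \<ge> 1" and z: "Re z > 0"
  shows set_integrable_laplace_h_g: "set_integrable lborel {0<..}
           (\<lambda>s. exp (- (of_real s * z)) * of_real (s ^ N * h_fun N s * g_fun n a b s))"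
    and set_integral_laplace_h_g: "(LINT s:{0<..}|lborel.
           exp (- (of_real s * z)) * of_real (s ^ N * h_fun N s * g_fun n a b s))
               = fact N * rho_zeta N 0 z"
proof -
  obtain R where R: "R \<ge> 0" "\<And>u. \<bar>rho n a b u\<bar> \<le> R" using ex_rho_bound by blast
  have zm: "Re (z + of_nat m) > 0" for m using z by (simp add: add_pos_nonneg)
  define L where "L m s = of_real s ^ N * exp (- (of_real s * (z + of_nat m)))
      * complex_of_real (g_fun n a b s)"
    for m and s :: real
  define f where "f m s = indicator {0<..} s *\<^sub>R (of_nat (num_compositions N m) * L m s)" for m s
  have int_L: "set_integrable lborel {0<..} (L m)" for m
    unfolding L_def[abs_def] by (rule set_integrable_laplace_g[OF zm])
  have int: "integrable lborel (f m)" for m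
    using set_integrable_mult_right[OF int_L, of "of_nat (num_compositions N m)" m]
    by (simp add: f_def[abs_def] set_integrable_def)
  have norm_L: "norm (L m s) \<le> T * R * (s ^ N * exp (- (s * Re (z + of_nat m))))" if "s > 0" for m s
  proof -
    have "norm (L m s) = s ^ N * exp (- (s * Re (z + of_nat m))) * \<bar>g_fun n a b s\<bar>"
      using that by (simp add: L_def norm_mult norm_power norm_exp_eq_Re)
    also have "\<dots> \<le> s ^ N * exp (- (s * Re (z + of_nat m))) * (T * R)"
      using that by (intro mult_left_mono abs_g_fun_le R) auto
    finally show ?thesis by (simp only: mult.commute)
  qed
  have le: "(\<integral>s. norm (f m s) \<partial>lborel) \<le>
      T * R * fact N * (real (num_compositions N m) * (1 / (Re z + real m) ^ (N + 1)))" for m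
  proof -
    have "(LINT s:{0<..}|lborel. norm (L m s)) \<le>
        (LINT s:{0<..}|lborel. T * R * (s ^ N * exp (- (s * Re (z + of_nat m)))))"
    proof (rule set_integral_mono)
      show "set_integrable lborel {0<..} (\<lambda>s. norm (L m s))"
        by (rule set_integrable_norm[OF int_L])
      show "set_integrable lborel {0<..} (\<lambda>s. T * R * (s ^ N * exp (- (s * Re (z + of_nat m)))))"
        using set_integrable_power_mult_exp_neg(1)[OF zm] by (intro set_integrable_mult_right) auto
    qed (use norm_L in auto)
    also have "\<dots> = T * R * (fact N / Re (z + of_nat m) ^ (N + 1))"
      by (simp only: set_integral_mult_right set_integrable_power_mult_exp_neg(2)[OF zm])
    finally have L_le: "(LINT s:{0<..}|lborel. norm (L m s))
        \<le> T * R * (fact N / Re (z + of_nat m) ^ (N + 1))" .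
    have "(\<integral>s. norm (f m s) \<partial>lborel) = (LINT s:{0<..}|lborel. real (num_compositions N m)
        * norm (L m s))"
      unfolding set_lebesgue_integral_def
      by (intro Bochner_Integration.integral_cong refl) (simp add: f_def norm_mult)
    also have "\<dots> = real (num_compositions N m) * (LINT s:{0<..}|lborel. norm (L m s))"
      by (rule set_integral_mult_right)
    also have "\<dots> \<le> real (num_compositions N m) * (T * R * (fact N / Re (z + of_nat m) ^ (N + 1)))"
      by (intro mult_left_mono L_le) simp
    finally show ?thesis by (simp add: mult_ac)
  qed
  have sums: "summable (\<lambda>m. \<integral>s. norm (f m s) \<partial>lborel)"
    by (rule summable_comparison_test'[OF summable_mult[OF
        summable_num_compositions_inverse_power[OF z],
            of "T * R * fact N" N]])
       (use le in \<open>simp add: integral_nonneg_AE\<close>)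
  have L_split: "of_nat (num_compositions N m) * L m s = of_real s ^ N * exp (- (of_real s * z)) *
      complex_of_real (g_fun n a b s) * of_real (real (num_compositions N m)
          * exp (- (real m * s)))" for m s
  proof -
    have "exp (- (of_real s * (z + of_nat m))) = exp (- (of_real s * z))
        * complex_of_real (exp (- (real m * s)))"
      by (simp add: exp_of_real[symmetric] algebra_simps flip: exp_add)
    then show ?thesis by (simp add: L_def)
  qed
  have summ: "summable (\<lambda>m. norm (f m s))" for s
  proof (cases "s > 0")
    case True
    have "summable (\<lambda>m. norm (of_real s ^ N * exp (- (of_real s * z))
        * complex_of_real (g_fun n a b s)) *
       (real (num_compositions N m) * exp (- (real m * s))))"
      by (rule summable_mult[OF summable_num_compositions_exp[OF True]])
    also have "(\<lambda>m. norm (of_real s ^ N * exp (- (of_real s * z)) * complex_of_real (g_fun n a b s)) *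
       (real (num_compositions N m) * exp (- (real m * s)))) = (\<lambda>m. norm (f m s))"
      using True unfolding f_def L_split by (simp add: norm_mult)
    finally show ?thesis .
  qed (simp add: f_def)
  have h_eq: "indicator {0<..} s *\<^sub>R (exp (- (of_real s * z)) * of_real (s ^ N * h_fun N s
      * g_fun n a b s))
      = (\<Sum>m. f m s)" for s
  proof (cases "s > 0")
    case True
    have "(\<lambda>m. real (num_compositions N m) * exp (- (real m * s))) sums h_fun N s"
      unfolding h_fun_def num_compositions_eq_binomial[OF N, symmetric]
      by (rule summable_sums[OF summable_num_compositions_exp[OF True]])
    then have "(\<lambda>m. of_nat (num_compositions N m) * L m s) sums
        (of_real s ^ N * exp (- (of_real s * z)) * complex_of_real (g_fun n a b s)
            * of_real (h_fun N s))"
      unfolding L_split by (intro sums_mult sums_of_real)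
    then show ?thesis using True by (simp add: f_def sums_iff mult_ac)
  qed (simp add: f_def)
  show "set_integrable lborel {0<..}
           (\<lambda>s. exp (- (of_real s * z)) * of_real (s ^ N * h_fun N s * g_fun n a b s))"
    unfolding set_integrable_def h_eq by (rule integrable_suminf[OF int _ sums]) (use summ in simp)
  have "(LINT s:{0<..}|lborel. exp (- (of_real s * z)) * of_real (s ^ N * h_fun N s * g_fun n a b s)) =
      (\<integral>s. (\<Sum>m. f m s) \<partial>lborel)"
    unfolding set_lebesgue_integral_def h_eq ..
  also have "(\<lambda>m. integral\<^sup>L lborel (f m)) sums \<dots>"
    by (rule sums_integral[OF int _ sums]) (use summ in simp)
  finally have *: "(\<lambda>m. integral\<^sup>L lborel (f m)) sums
     (LINT s:{0<..}|lborel. exp (- (of_real s * z)) * of_real (s ^ N * h_fun N s * g_fun n a b s))" .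
  have eq: "integral\<^sup>L lborel (f m) = fact N * (of_nat (num_compositions N m)
      * rho_power N (z + of_nat m))" for m
  proof -
    have "integral\<^sup>L lborel (f m) = (LINT s:{0<..}|lborel. of_nat (num_compositions N m) * L m s)"
      by (simp only: f_def[abs_def] set_lebesgue_integral_def)
    also have "\<dots> = of_nat (num_compositions N m) * (LINT s:{0<..}|lborel. L m s)"
      by (rule set_integral_mult_right)
    also have "(LINT s:{0<..}|lborel. L m s) = fact N * rho_power N (z + of_nat m)"
      unfolding L_def by (rule set_integral_laplace_g[OF zm])
    finally show ?thesis by (simp only: mult.left_commute)
  qed
  have "summable (\<lambda>m. of_nat (num_compositions N m) * rho_power N (z + of_nat m))"
  proof -
    have "summable (\<lambda>m. fact N * (of_nat (num_compositions N m) * rho_power N (z + of_nat m)))"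
      using sums_summable[OF *] unfolding eq .
    then show ?thesis by (simp add: summable_cmult_iff)
  qed
  from suminf_mult[OF this, of "fact N"] sums_unique[OF *]
  show "(LINT s:{0<..}|lborel. exp (- (of_real s * z)) * of_real (s ^ N * h_fun N s
      * g_fun n a b s)) = fact N * rho_zeta N 0 z"
    unfolding eq rho_zeta_eq_suminf[OF z] by simp
qed

end

theorem corollary1p4:
  fixes N n :: nat and a b :: "nat \<Rightarrow> real" and z :: complex
  assumes "N \<ge> 1"
    and "\<And>k. k \<in> {1..n} \<Longrightarrow> 0 \<le> a k" and "mono_on {1..n} a"
    and "\<And>k. k \<in> {1..n} \<Longrightarrow> 0 \<le> b k" and "mono_on {1..n} b"
    and "(\<Sum>k=1..n. a k) = (\<Sum>k=1..n. b k)"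
    and "Re z > 0"
  shows "set_integrable lborel {0<..}
           (\<lambda>s. exp (- (of_real s * z)) * of_real (s ^ N * h_fun N s * g_fun n a b s)) \<and>
         set_integrable lborel {0<..}
           (\<lambda>t. of_real (phi N n a b t) / (z + of_real t) ^ (N + 1)) \<and>
         (- 1) ^ N * (deriv ^^ (N - 1)) (log_W (\<lambda>w. 1 / barnes_Gamma N w) n a b) z =
           (LINT s:{0<..}|lborel.
              exp (- (of_real s * z)) * of_real (s ^ N * h_fun N s * g_fun n a b s)) \<and>
         (LINT s:{0<..}|lborel.
            exp (- (of_real s * z)) * of_real (s ^ N * h_fun N s * g_fun n a b s)) =
           Gamma (of_nat (N + 1)) *
           (LINT t:{0<..}|lborel. of_real (phi N n a b t) / (z + of_real t) ^ (N + 1))"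
proof -
  interpret balanced_shifts n a b
    using assms by unfold_locales auto
  have "Gamma (of_nat (N + 1) :: complex) = fact N"
    using Gamma_fact[of N, where 'a = complex] by (simp add: add.commute)
  then show ?thesis
    using set_integrable_laplace_h_g[OF assms(1,7)] set_integral_laplace_h_g[OF assms(1,7)]
      set_integrable_phi[OF assms(1,7)] set_integral_phi[OF assms(1,7)]
      higher_deriv_log_W[OF assms(1,7)]
    by simp
qed

end
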